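(* Let $A \in \mathbb{F}^{n\times n}$ be a matrix satisfying property $\mathcal{R}$, and let $B \in \mathbb{F}^{n \times n}$ be such that $\det(A[S]) = \det(B[S])$ for all nonempty $S \subseteq [n]$ with $|S| \le 4$. Then $\det(A[S]) = \det(B[S])$ for all nonempty $S \subseteq [n]$.
   Context: For $S, T \subseteq [n]$, $A[S,T]$ denotes the submatrix of $A$ with rows indexed by $S$ and columns indexed by $T$, $A[S] = A[S,S]$, and $\overline{S} = [n] \setminus S$. A matrix $A \in \mathbb{F}^{n \times n}$ satisfies property $\mathcal{R}$ if (i) all off-diagonal entries of $A$ are nonzero, and (ii) whenever $i,j,k,\ell \in [n]$ are distinct with $\mathrm{rank}(A[\{i,j\},\{k,\ell\}]) = 1$, there exists $S \subseteq [n]$ with $i, j \in S$ and $k, \ell \in \overline{S}$ such that $\mathrm{rank}(A[S, \overline{S}]) = 1$. *)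

theory Defs
  imports "Jordan_Normal_Form.DL_Rank_Submatrix" "Jordan_Normal_Form.Determinant"
begin

text \<open>Indices are zero-based: \<open>[n]\<close> is rendered as \<open>{0..<n}\<close>. The library function
  \<open>submatrix A S T\<close> is \<open>A[S,T]\<close> with rows and columns listed in increasing order.\<close>

text \<open>The library's column rank is parametrised by the length of the column vectors.\<close>

definition mat_rank :: "'a::field mat \<Rightarrow> nat" where
  "mat_rank A = vec_space.rank (dim_row A) A"

definition principal_submatrix :: "'a mat \<Rightarrow> nat set \<Rightarrow> 'a mat" where
  "principal_submatrix A S = submatrix A S S"

definition property_R :: "nat \<Rightarrow> 'a::field mat \<Rightarrow> bool" where
  "property_R n A \<longleftrightarrow>
     A \<in> carrier_mat n n \<and>
     (\<forall>i\<in>{0..<n}. \<forall>j\<in>{0..<n}. i \<noteq> j \<longrightarrow> A $$ (i, j) \<noteq> 0) \<and>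
     (\<forall>i\<in>{0..<n}. \<forall>j\<in>{0..<n}. \<forall>k\<in>{0..<n}. \<forall>l\<in>{0..<n}.
        distinct [i, j, k, l] \<longrightarrow>
        mat_rank (submatrix A {i, j} {k, l}) = 1 \<longrightarrow>
        (\<exists>S \<subseteq> {0..<n}. i \<in> S \<and> j \<in> S \<and> k \<in> {0..<n} - S \<and> l \<in> {0..<n} - S \<and>
           mat_rank (submatrix A S ({0..<n} - S)) = 1))"

end

theory Submission
  imports Defs
begin

text \<open>Let \<open>f, g\<close> be the two matrices. Scaling rows and columns so that row and column of a base vertex
  \<open>b\<close> become 1, the minors of order at most 3 show that \<open>g\<close> agrees on each pair of vertices with \<open>f\<close> (red)
  or with its transpose (blue). If only one colour occurs, the determinants agree. The minors
  of order 4 exclude triangles with a red, a blue and a symmetric edge, and in a triangle \<open>ijk\<close> in which only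
  \<open>jk\<close> has the minority colour, \<open>j\<close> and \<open>k\<close> are twins as seen from \<open>i\<close>. Property R then yields a clan, that is,
  a vertex set whose rows and columns have rank one outside it, that contains \<open>j, k\<close> but not \<open>b, i\<close>: otherwise
  take a shortest sequence of vertices, each splitting the set of the previous ones, that leads from
  \<open>{j, k}\<close> to \<open>i\<close>; colour considerations produce a shorter one for another bad triangle.

  Now induct on the size. A clan of both matrices expresses the determinant through smaller minors.
  A minimal clan of \<open>f\<close> with at least three elements has edges of one colour only and is a clan
  of \<open>g\<close> as well. For a minimal clan \<open>{j, k}\<close> use that the difference of the determinants does not depend on
  the diagonal, since the smaller minors agree, and choose two diagonal entries that make both determinants vanish.\<close>

text \<open>The colouring is rigid for two reasons. A minor of order 3 away from the base controls a
  product, and a minor of order 4 through the base controls the matching sum. Two numbers with given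
  sum and product are determined up to order, and this is what makes twins. The obstacle is that
  colours depend on the base: a change of base rescales the entries and can turn neutral pairs into
  coloured ones. The same effect is also the main device, since equality of principal minors does
  not depend on the base. When the critical vertices are joined only by neutral edges and no
  triangle lemma applies, moving the base to one end of a red edge creates the missing colours.
  Transposing both matrices, or \<open>g\<close> alone, preserves all hypotheses; the first
  exchanges rows with columns, the second red with blue. Two-element clans are separate because
  \<open>g\<close> may tell \<open>j\<close> and \<open>k\<close> apart, so its determinant need not
  have the clan expansion of \<open>f\<close>.\<close>

section \<open>Principal minors indexed by sets\<close>

text \<open>A permutation sum over \<open>S\<close> itself needs no enumeration of \<open>S\<close>, so that block arguments
  for arbitrary subsets do not involve reordering rows.\<close>

definition pdet :: "('v \<Rightarrow> 'v \<Rightarrow> 'a::comm_ring_1) \<Rightarrow> 'v set \<Rightarrow> 'a" where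
  "pdet f S = (\<Sum>p | p permutes S. of_int (sign p) * (\<Prod>i\<in>S. f i (p i)))"

lemma pdet_cong:
  assumes "\<And>i k. i \<in> S \<Longrightarrow> k \<in> S \<Longrightarrow> f i k = g i k"
  shows "pdet f S = pdet g S"
  unfolding pdet_def
  by (intro sum.cong refl arg_cong2[of _ _ _ _ "(*)"] prod.cong assms)
    (auto simp: permutes_in_image)

text \<open>Conjugation by \<open>e\<close> carries permutations of positions to permutations of
  \<open>S\<close> and keeps signs. As \<open>e\<close> need not be increasing, facts about
  \<open>det\<close> can be imported along any enumeration.\<close>

lemma pdet_eq_det:
  assumes e: "bij_betw e {0..<n} S"
  shows "pdet f S = det (mat n n (\<lambda>(i, k). f (e i) (e k)))"
proof -
  let ?N = "{0..<n}"
  let ?e' = "inv_into ?N e"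
  have e': "bij_betw ?e' S ?N" using e by (rule bij_betw_inv_into)
  have inj: "inj_on e ?N" and img: "e ` ?N = S" using e by (auto simp: bij_betw_def)
  have "(\<Sum>p | p permutes ?N. of_int (sign p) * (\<Prod>i\<in>?N. f (e i) (e (p i)))) = pdet f S"
    unfolding pdet_def
  proof (rule sum.reindex_bij_witness[where i = "map_permutation S ?e'" and j = "map_permutation ?N e"])
    fix p assume "p \<in> {p. p permutes ?N}"
    then have p: "p permutes ?N" by simp
    show "map_permutation S ?e' (map_permutation ?N e p) = p"
      by (rule map_permutation_compose_inv[OF e p]) (use e in \<open>auto simp: bij_betw_def\<close>)
    show "map_permutation ?N e p \<in> {p. p permutes S}"
      using map_permutation_permutes[OF e p] by simp
    have "sign (map_permutation ?N e p) = sign p"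
      by (rule sign_map_permutation[OF inj p]) simp
    moreover have "(\<Prod>i\<in>S. f i (map_permutation ?N e p i)) = (\<Prod>i\<in>?N. f (e i) (e (p i)))"
      unfolding img[symmetric] prod.reindex[OF inj] o_def
      by (intro prod.cong refl) (simp add: map_permutation_apply[OF inj])
    ultimately show "of_int (sign (map_permutation ?N e p)) * (\<Prod>i\<in>S. f i (map_permutation ?N e p i))
        = of_int (sign p) * (\<Prod>i\<in>?N. f (e i) (e (p i)))" by simp
  next
    fix p assume "p \<in> {p. p permutes S}"
    then have p: "p permutes S" by simp
    show "map_permutation S ?e' p \<in> {p. p permutes ?N}"
      using map_permutation_permutes[OF e' p] by simp
    show "map_permutation ?N e (map_permutation S ?e' p) = p"
      by (rule map_permutation_compose_inv[OF e' p]) (use e in \<open>auto simp: bij_betw_def f_inv_into_f\<close>)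
  qed
  moreover have "det (mat n n (\<lambda>(i, k). f (e i) (e k))) =
      (\<Sum>p | p permutes ?N. of_int (sign p) * (\<Prod>i\<in>?N. f (e i) (e (p i))))"
  proof -
    have "(\<Prod>i = 0..<n. mat n n (\<lambda>(i, k). f (e i) (e k)) $$ (i, p i)) = (\<Prod>i\<in>?N. f (e i) (e (p i)))"
      if "p permutes ?N" for p
      by (intro prod.cong refl) (use permutes_in_image[OF that] in simp)
    then show ?thesis by (subst det_def'[of _ n]) (simp_all cong: sum.cong_simp)
  qed
  ultimately show ?thesis by simp
qed

lemma pdet_transpose:
  assumes "finite S"
  shows "pdet (\<lambda>i k. f k i) S = pdet f S"
proof -
  obtain e where e: "bij_betw e {0..<card S} S"
    using ex_bij_betw_nat_finite[OF assms] by blast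
  have "mat (card S) (card S) (\<lambda>(i, k). f (e k) (e i))
      = transpose_mat (mat (card S) (card S) (\<lambda>(i, k). f (e i) (e k)))"
    by (rule eq_matI) auto
  then show ?thesis
    using det_transpose[of "mat (card S) (card S) (\<lambda>(i, k). f (e i) (e k))" "card S"]
    by (simp add: pdet_eq_det[OF e])
qed

lemma pdet_identical_rows:
  assumes "finite S" "i \<in> S" "j \<in> S" "i \<noteq> j" "\<And>k. k \<in> S \<Longrightarrow> f i k = f j k"
  shows "pdet f S = 0"
proof -
  obtain e where e: "bij_betw e {0..<card S} S"
    using ex_bij_betw_nat_finite[OF assms(1)] by blast
  then have img: "e ` {0..<card S} = S" by (simp add: bij_betw_def)
  obtain a where a: "a < card S" "e a = i" using assms(2) img by force
  obtain c where c: "c < card S" "e c = j" using assms(3) img by force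
  let ?M = "mat (card S) (card S) (\<lambda>(i, k). f (e i) (e k))"
  have "det ?M = 0"
  proof (rule det_identical_rows[of _ "card S" a c])
    show "a \<noteq> c" using a c assms(4) by auto
    show "row ?M a = row ?M c"
    proof (rule eq_vecI)
      fix k assume "k < dim_vec (row ?M c)"
      then have "k < card S" "e k \<in> S" using img by auto
      then show "row ?M a $ k = row ?M c $ k" using a c assms(5) by simp
    qed simp
  qed (use a c in auto)
  then show ?thesis by (simp add: pdet_eq_det[OF e])
qed

section \<open>Row operations and block structure\<close>

lemma pdet_row_split:
  assumes "finite S" "j \<in> S"
  shows "pdet (f(j := r)) S =
    (\<Sum>p | p permutes S. of_int (sign p) * (r (p j) * (\<Prod>i\<in>S - {j}. f i (p i))))"
  unfolding pdet_def
  by (intro sum.cong refl arg_cong2[of _ _ _ _ "(*)"])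
    (auto simp: prod.remove[OF assms] intro!: prod.cong)

lemma pdet_row_add:
  assumes "finite S" "j \<in> S"
  shows "pdet (f(j := \<lambda>k. u k + v k)) S = pdet (f(j := u)) S + pdet (f(j := v)) S"
  unfolding pdet_row_split[OF assms] sum.distrib[symmetric]
  by (intro sum.cong refl) (simp add: algebra_simps)

lemma pdet_row_scale:
  assumes "finite S" "j \<in> S"
  shows "pdet (f(j := \<lambda>k. c * u k)) S = c * pdet (f(j := u)) S"
  unfolding pdet_row_split[OF assms] sum_distrib_left
  by (intro sum.cong refl) (simp add: algebra_simps)

lemma pdet_scale:
  assumes "finite S"
  shows "pdet (\<lambda>i k. c i * d k * f i k) S = (\<Prod>i\<in>S. c i * d i) * pdet f S"
  unfolding pdet_def sum_distrib_left
proof (intro sum.cong refl)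
  fix p assume "p \<in> {p. p permutes S}"
  then have "(\<Prod>i\<in>S. d (p i)) = (\<Prod>i\<in>S. d i)"
    by (metis mem_Collect_eq permutes_imp_bij prod.reindex_bij_betw)
  then show "of_int (sign p) * (\<Prod>i\<in>S. c i * d (p i) * f i (p i))
      = (\<Prod>i\<in>S. c i * d i) * (of_int (sign p) * (\<Prod>i\<in>S. f i (p i)))"
    by (simp add: prod.distrib algebra_simps)
qed

lemma pdet_subtract_row:
  assumes S: "finite S" and j: "j \<in> S" "j \<notin> T" and T: "T \<subseteq> S"
  shows "pdet (\<lambda>i k. if i \<in> T then f i k - f j k else f i k) S = pdet f S"
proof -
  have "finite T" using T S by (rule finite_subset)
  then show ?thesis using j T
  proof (induction T rule: finite_induct)
    case (insert t T)
    let ?g = "\<lambda>i k. if i \<in> T then f i k - f j k else f i k"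
    have t: "t \<in> S" "t \<noteq> j" using insert by auto
    have "(\<lambda>i k. if i \<in> insert t T then f i k - f j k else f i k)
        = ?g(t := \<lambda>k. f t k + (- 1) * f j k)"
      using insert.hyps by (auto simp: fun_eq_iff)
    then have "pdet (\<lambda>i k. if i \<in> insert t T then f i k - f j k else f i k) S
        = pdet (?g(t := f t)) S + (- 1) * pdet (?g(t := f j)) S"
      by (simp only: pdet_row_add[OF S t(1)] pdet_row_scale[OF S t(1)])
    moreover have "pdet (?g(t := f j)) S = 0"
      by (rule pdet_identical_rows[OF S t(1) j(1) t(2)]) (use insert in auto)
    moreover have "?g(t := f t) = ?g" using insert.hyps by (auto simp: fun_eq_iff)
    ultimately show ?case using insert by simp
  qed simp
qed

lemma pdet_subtract_col:
  assumes "finite S" "j \<in> S" "j \<notin> T" "T \<subseteq> S"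
  shows "pdet (\<lambda>i k. if k \<in> T then f i k - f i j else f i k) S = pdet f S"
  using pdet_subtract_row[OF assms, of "\<lambda>i k. f k i"]
    pdet_transpose[OF assms(1), of f]
    pdet_transpose[OF assms(1), of "\<lambda>i k. if k \<in> T then f i k - f i j else f i k"]
  by simp

text \<open>A permutation that moves a point of \<open>X\<close> into \<open>Y\<close> picks a zero
  entry. The others preserve \<open>X\<close> and, by injectivity and finiteness, also
  \<open>Y\<close>, so they factor into a permutation of each.\<close>

lemma pdet_block:
  assumes fin: "finite X" "finite Y" and disj: "X \<inter> Y = {}"
    and zero: "\<And>i k. i \<in> X \<Longrightarrow> k \<in> Y \<Longrightarrow> f i k = 0"
  shows "pdet f (X \<union> Y) = pdet f X * pdet f Y"
proof -
  let ?P = "{p. p permutes (X \<union> Y)}"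
  let ?Q = "{p. p permutes (X \<union> Y) \<and> p ` X \<subseteq> X}"
  let ?t = "\<lambda>S p. of_int (sign p) * (\<Prod>i\<in>S. f i (p i))"
  have finP: "finite ?P" using fin by (simp add: finite_permutations)
  have "pdet f (X \<union> Y) = sum (?t (X \<union> Y)) ?P" by (simp add: pdet_def)
  also have "\<dots> = sum (?t (X \<union> Y)) ?Q"
  proof (rule sum.mono_neutral_right[OF finP])
    show "\<forall>p\<in>?P - ?Q. ?t (X \<union> Y) p = 0"
    proof
      fix p assume "p \<in> ?P - ?Q"
      then obtain i where i: "i \<in> X" "p i \<notin> X" and p: "p permutes (X \<union> Y)" by auto
      then have "p i \<in> Y" using permutes_in_image[OF p, of i] by auto
      then have "f i (p i) = 0" using zero i by auto
      then have "(\<Prod>i\<in>X \<union> Y. f i (p i)) = 0" using i fin by (intro prod_zero) auto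
      then show "?t (X \<union> Y) p = 0" by simp
    qed
  qed auto
  also have "\<dots> = (\<Sum>(p, q)\<in>{p. p permutes X} \<times> {q. q permutes Y}. ?t X p * ?t Y q)"
  proof (rule sym, rule sum.reindex_bij_witness[where j = "\<lambda>(p, q). p \<circ> q"
        and i = "\<lambda>r. (restrict_id r X, restrict_id r Y)"])
    fix a assume "a \<in> {p. p permutes X} \<times> {q. q permutes Y}"
    then obtain p q where a: "a = (p, q)" and p: "p permutes X" and q: "q permutes Y" by auto
    have pq: "(p \<circ> q) i = (if i \<in> X then p i else q i)" for i
    proof (cases "i \<in> Y")
      case True
      then have "q i \<in> Y" using permutes_in_image[OF q] by simp
      then have "q i \<notin> X" using disj by auto
      then have "p (q i) = q i" using permutes_not_in[OF p] by simp
      then show ?thesis using True disj by auto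
    next
      case False
      then have "q i = i" using permutes_not_in[OF q] by simp
      then show ?thesis using permutes_not_in[OF p, of i] by simp
    qed
    show "(\<lambda>r. (restrict_id r X, restrict_id r Y)) ((\<lambda>(p, q). p \<circ> q) a) = a"
      using permutes_not_in[OF p] permutes_not_in[OF q] disj
      by (auto simp: a restrict_id_def fun_eq_iff pq simp del: o_apply)
    have "p permutes (X \<union> Y)" "q permutes (X \<union> Y)"
      using p q by (auto intro: permutes_subset)
    then have "(p \<circ> q) permutes (X \<union> Y)" by (intro permutes_compose)
    moreover have "(p \<circ> q) ` X \<subseteq> X"
      using permutes_in_image[OF p] by (auto simp: pq simp del: o_apply)
    ultimately show "(\<lambda>(p, q). p \<circ> q) a \<in> ?Q" by (simp add: a)
    have "sign (p \<circ> q) = sign p * sign q"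
      using p q fin by (intro sign_compose) (auto simp: permutation_permutes)
    moreover have "(\<Prod>i\<in>X \<union> Y. f i ((p \<circ> q) i)) = (\<Prod>i\<in>X. f i (p i)) * (\<Prod>i\<in>Y. f i (q i))"
      unfolding prod.union_disjoint[OF fin disj] pq
      by (intro arg_cong2[of _ _ _ _ "(*)"] prod.cong) (use disj in auto)
    ultimately show "?t (X \<union> Y) ((\<lambda>(p, q). p \<circ> q) a) = (case a of (p, q) \<Rightarrow> ?t X p * ?t Y q)"
      by (simp add: a algebra_simps del: o_apply)
  next
    fix r assume "r \<in> ?Q"
    then have r: "r permutes (X \<union> Y)" and rX: "r ` X \<subseteq> X" by auto
    have inj: "inj_on r A" for A using permutes_inj[OF r] by (rule inj_on_subset) simp
    have rX': "r ` X = X" using rX inj fin(1) by (simp add: endo_inj_surj)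
    have rY': "r ` Y = Y"
    proof -
      have "r ` Y \<subseteq> Y"
      proof
        fix z assume "z \<in> r ` Y"
        then obtain y where y: "y \<in> Y" "z = r y" by auto
        have "r y \<notin> X"
        proof
          assume "r y \<in> X"
          then obtain x where "x \<in> X" "r x = r y" using rX' by (metis imageE)
          then have "x = y" using permutes_inj[OF r] by (auto dest: injD)
          then show False using \<open>x \<in> X\<close> y disj by auto
        qed
        then show "z \<in> Y" using permutes_in_image[OF r, of y] y by auto
      qed
      then show ?thesis using inj fin(2) by (simp add: endo_inj_surj)
    qed
    have 1: "restrict_id r X permutes X" "restrict_id r Y permutes Y"
      using rX' rY' inj by (auto simp: bij_betw_def intro!: permutes_restrict_id)
    then show "(\<lambda>r. (restrict_id r X, restrict_id r Y)) r \<in> {p. p permutes X} \<times> {q. q permutes Y}"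
      by simp
    show "(\<lambda>(p, q). p \<circ> q) ((\<lambda>r. (restrict_id r X, restrict_id r Y)) r) = r"
    proof -
      have "restrict_id r X (restrict_id r Y i) = r i" for i
      proof (cases "i \<in> Y")
        case True
        then have "r i \<in> Y" using rY' by auto
        then have "r i \<notin> X" using disj by auto
        then show ?thesis using True by (simp add: restrict_id_def)
      next
        case False
        then show ?thesis using permutes_not_in[OF r, of i] by (auto simp: restrict_id_def)
      qed
      then show ?thesis by (auto simp: fun_eq_iff)
    qed
  qed
  also have "\<dots> = pdet f X * pdet f Y"
    unfolding pdet_def sum_product sum.cartesian_product ..
  finally show ?thesis .
qed

text \<open>Pigeonhole, as in the Frobenius-Koenig theorem: no permutation maps \<open>T\<close>
  into the smaller set \<open>C\<close>, so every term contains a zero entry.\<close>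

lemma pdet_zero_block:
  assumes S: "finite S" and T: "T \<subseteq> S" "C \<subseteq> S" "card C < card T"
    and zero: "\<And>i k. i \<in> T \<Longrightarrow> k \<in> S - C \<Longrightarrow> f i k = 0"
  shows "pdet f S = 0"
  unfolding pdet_def
proof (intro sum.neutral ballI)
  fix p assume "p \<in> {p. p permutes S}"
  then have p: "p permutes S" by simp
  have "\<not> p ` T \<subseteq> C"
  proof
    assume "p ` T \<subseteq> C"
    moreover have "card (p ` T) = card T"
      using permutes_inj[OF p] by (intro card_image) (auto intro: inj_on_subset)
    ultimately show False
      using T S by (metis card_mono finite_subset not_le)
  qed
  then obtain i where i: "i \<in> T" "p i \<notin> C" by auto
  then have "p i \<in> S - C" using permutes_in_image[OF p, of i] T by auto
  then have "f i (p i) = 0" using zero i by auto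
  then have "(\<Prod>i\<in>S. f i (p i)) = 0" using i T S by (intro prod_zero) auto
  then show "of_int (sign p) * (\<Prod>i\<in>S. f i (p i)) = 0" by simp
qed

lemma pdet_empty [simp]: "pdet f {} = 1"
  by (simp add: pdet_def)

lemma pdet_single [simp]: "pdet f {i} = f i i"
  by (simp add: pdet_def)

text \<open>The row added at \<open>j\<close> is \<open>t\<close> times a unit vector, whose
  contribution \<open>pdet_block\<close> reduces to the complementary minor.\<close>

lemma pdet_add_diag:
  assumes S: "finite S" and j: "j \<in> S"
  shows "pdet (f(j := (f j)(j := f j j + t))) S = pdet f S + t * pdet f (S - {j})"
proof -
  let ?e = "\<lambda>k. if k = j then 1 else 0"
  have "f(j := (f j)(j := f j j + t)) = f(j := \<lambda>k. f j k + t * ?e k)"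
    by (auto simp: fun_eq_iff)
  then have "pdet (f(j := (f j)(j := f j j + t))) S = pdet (f(j := f j)) S + t * pdet (f(j := ?e)) S"
    by (simp only: pdet_row_add[OF S j] pdet_row_scale[OF S j])
  moreover have "pdet (f(j := ?e)) ({j} \<union> (S - {j}))
      = pdet (f(j := ?e)) {j} * pdet (f(j := ?e)) (S - {j})"
    by (rule pdet_block) (use S in auto)
  moreover have "pdet (f(j := ?e)) (S - {j}) = pdet f (S - {j})" by (rule pdet_cong) auto
  moreover have "{j} \<union> (S - {j}) = S" using j by auto
  ultimately show ?thesis by simp
qed

text \<open>A permutation of \<open>insert a S\<close> is a permutation of \<open>S\<close> followed
  by the transposition of \<open>a\<close> with its image. Replacing column \<open>b\<close> by
  column \<open>a\<close> keeps the index set \<open>S\<close>, so repeated rewriting evaluates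
  minors over explicit sets.\<close>

lemma pdet_insert:
  assumes S: "finite S" and a: "a \<notin> S"
  shows "pdet f (insert a S) =
    f a a * pdet f S - (\<Sum>b\<in>S. f a b * pdet (\<lambda>i k. f i (if k = b then a else k)) S)"
proof -
  let ?t = "\<lambda>b q. of_int (sign (transpose a b \<circ> q)) * (\<Prod>i\<in>insert a S. f i ((transpose a b \<circ> q) i))"
  have t: "?t b q = (if b = a then 1 else -1) * f a b *
      (of_int (sign q) * (\<Prod>i\<in>S. f i (if q i = b then a else q i)))"
    if q: "q permutes S" and b: "b \<in> insert a S" for b q
  proof -
    have "sign (transpose a b \<circ> q) = sign (transpose a b) * sign q"
      using q S by (intro sign_compose permutation_swap_id) (auto simp: permutation_permutes)
    moreover have "q a = a" using q a by (rule permutes_not_in)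
    moreover have "transpose a b (q i) = (if q i = b then a else q i)" if "i \<in> S" for i
      using that permutes_in_image[OF q] a by (auto simp: Transposition.transpose_def)
    ultimately show ?thesis
      using S a by (simp add: sign_swap_id)
  qed
  have "pdet f (insert a S) = (\<Sum>b\<in>insert a S. \<Sum>q | q permutes S. ?t b q)"
    unfolding pdet_def by (rule sum_over_permutations_insert[OF S a])
  also have "\<dots> = (\<Sum>b\<in>insert a S. (if b = a then 1 else -1) * f a b *
      pdet (\<lambda>i k. f i (if k = b then a else k)) S)"
    unfolding pdet_def sum_distrib_left by (intro sum.cong refl t) auto
  also have "\<dots> = f a a * pdet (\<lambda>i k. f i (if k = a then a else k)) S
      + (\<Sum>b\<in>S. - (f a b * pdet (\<lambda>i k. f i (if k = b then a else k)) S))"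
    using S a by (subst sum.insert) (auto intro!: sum.cong)
  also have "pdet (\<lambda>i k. f i (if k = a then a else k)) S = pdet f S" by (rule pdet_cong) simp
  finally show ?thesis by (simp add: sum_negf)
qed

section \<open>Determinants of order two to four\<close>

lemma pdet_2:
  assumes "a \<noteq> b"
  shows "pdet f {a, b} = f a a * f b b - f a b * f b a"
  using assms by (simp add: pdet_insert)

lemma pdet_3:
  assumes "distinct [a, b, c]"
  shows "pdet f {a, b, c} = f a a * f b b * f c c - f a a * f b c * f c b - f b b * f a c * f c a
    - f c c * f a b * f b a + f a b * f b c * f c a + f a c * f c b * f b a"
  using assms by (simp add: pdet_insert algebra_simps)

text \<open>The terms are sorted by the length of the cycle through \<open>a\<close>. Everything
  except the six 4-cycles is thus built from quantities that already agree when the minors of order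
  at most 3 do.\<close>

lemma pdet_4:
  assumes "distinct [a, b, c, d]"
  shows "pdet f {a, b, c, d} = f a a * pdet f {b, c, d}
    - f a b * f b a * pdet f {c, d} - f a c * f c a * pdet f {b, d} - f a d * f d a * pdet f {b, c}
    + f d d * (f a b * f b c * f c a + f a c * f c b * f b a)
    + f c c * (f a b * f b d * f d a + f a d * f d b * f b a)
    + f b b * (f a c * f c d * f d a + f a d * f d c * f c a)
    - (f a b * f b c * f c d * f d a + f a b * f b d * f d c * f c a
     + f a c * f c b * f b d * f d a + f a c * f c d * f d b * f b a
     + f a d * f d b * f b c * f c a + f a d * f d c * f c b * f b a)"
  using assms by (simp add: pdet_insert algebra_simps)

text \<open>If all smaller minors agree, the difference of two determinants does not depend on the
  common diagonal, so two diagonal entries may be chosen at will.\<close>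

lemma pdet_eq_by_diag:
  assumes fin: "finite S" and jk: "j \<in> S" "k \<in> S" "j \<noteq> k"
    and diag: "F j j = G j j" "F k k = G k k"
    and proper: "\<And>T. T \<subset> S \<Longrightarrow> pdet F T = pdet G T"
    and eq: "pdet (\<lambda>p q. if p = j \<and> q = j then a else if p = k \<and> q = k then c else F p q) S =
      pdet (\<lambda>p q. if p = j \<and> q = j then a else if p = k \<and> q = k then c else G p q) S"
  shows "pdet F S = pdet G S"
proof -
  have expand: "pdet (\<lambda>p q. if p = j \<and> q = j then a else if p = k \<and> q = k then c else H p q) S =
      pdet H S + (a - H j j) * pdet H (S - {j}) +
      (c - H k k) * (pdet H (S - {k}) + (a - H j j) * pdet H (S - {k} - {j}))" for H
  proof -
    let ?s = "a - H j j" and ?t = "c - H k k"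
    let ?H1 = "H(j := (H j)(j := H j j + ?s))"
    let ?H2 = "?H1(k := (?H1 k)(k := ?H1 k k + ?t))"
    have "(\<lambda>p q. if p = j \<and> q = j then a else if p = k \<and> q = k then c else H p q) = ?H2"
      using jk by (auto simp: fun_eq_iff)
    moreover have "pdet ?H2 S = pdet ?H1 S + ?t * pdet ?H1 (S - {k})"
      by (rule pdet_add_diag[OF fin jk(2)])
    moreover have "pdet ?H1 S = pdet H S + ?s * pdet H (S - {j})"
      by (rule pdet_add_diag[OF fin jk(1)])
    moreover have "pdet ?H1 (S - {k}) = pdet H (S - {k}) + ?s * pdet H (S - {k} - {j})"
      by (rule pdet_add_diag) (use fin jk in auto)
    ultimately show ?thesis by simp
  qed
  have "pdet F (S - {j}) = pdet G (S - {j})" "pdet F (S - {k}) = pdet G (S - {k})"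
    "pdet F (S - {k} - {j}) = pdet G (S - {k} - {j})"
    using proper jk by (metis Diff_subset Diff_iff insertI1 psubsetI subset_trans)+
  then show ?thesis using eq unfolding expand[of F] expand[of G] by (simp add: diag)
qed

text \<open>Subtracting row and column \<open>x\<close> from those of the other elements of \<open>X\<close> turns \<open>x\<close>
  into a cut vertex between \<open>X\<close> and its complement.\<close>

lemma pdet_clan:
  assumes S: "finite S" and X: "X \<subseteq> S" "x \<in> X"
    and out: "\<And>u y. u \<in> X \<Longrightarrow> y \<in> S - X \<Longrightarrow> f u y = f x y"
    and inn: "\<And>u y. u \<in> X \<Longrightarrow> y \<in> S - X \<Longrightarrow> f y u = f y x"
  defines "D \<equiv> pdet (\<lambda>i k. f i k - f x k - (f i x - f x x)) (X - {x})"
  shows "pdet f S = D * pdet f (insert x (S - X)) + (pdet f X - f x x * D) * pdet f (S - X)"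
proof -
  define X' where "X' = X - {x}"
  define g where "g = (\<lambda>i k. if i \<in> X' then f i k - f x k else f i k)"
  define h where "h = (\<lambda>i k. if k \<in> X' then g i k - g i x else g i k)"
  \<comment> \<open>Row \<open>x\<close> of \<open>h\<close> is split in two. With \<open>u\<close>,
    no row of \<open>X\<close> has an entry in \<open>S - X\<close>; with \<open>v\<close>, no row
    of \<open>insert x (S - X)\<close> has an entry in \<open>X'\<close>. Both determinants are then
    block triangular.\<close>
  define u where "u = (\<lambda>k. if k \<in> X' then h x k else 0)"
  define v where "v = (\<lambda>k. if k \<in> X' then 0 else h x k)"
  have finX: "finite X" using S X by (auto intro: finite_subset)
  have h_pdet: "pdet h T = pdet f T" if "finite T" "X \<subseteq> T" for T
  proof -
    have 1: "x \<in> T" "x \<notin> X'" "X' \<subseteq> T" using that X by (auto simp: X'_def)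
    show ?thesis
      using pdet_subtract_row[OF that(1) 1, of f] pdet_subtract_col[OF that(1) 1, of g]
      by (simp add: g_def h_def)
  qed
  have hx: "h x = (\<lambda>k. u k + v k)" by (auto simp: u_def v_def)
  have split: "pdet h T = pdet (h(x := u)) T + pdet (h(x := v)) T" if "finite T" "x \<in> T" for T
    using pdet_row_add[OF that, of h u v] by (simp flip: hx)
  have D: "pdet (h(x := v)) X' = D"
    unfolding D_def X'_def[symmetric] by (rule pdet_cong) (auto simp: h_def g_def X'_def)
  have zero1: "h i k = 0" if "i \<in> X'" "k \<in> S - X" for i k
    using that out by (auto simp: h_def g_def X'_def)
  have zero2: "h i k = 0" if "i \<in> S - X" "k \<in> X'" for i k
    using that inn by (auto simp: h_def g_def X'_def)
  have SX: "S = X \<union> (S - X)" "S = insert x (S - X) \<union> X'" "X = {x} \<union> X'"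
    using X by (auto simp: X'_def)
  have "pdet (h(x := u)) S = pdet (h(x := u)) X * pdet (h(x := u)) (S - X)"
    by (subst SX(1), rule pdet_block) (use S finX zero1 in \<open>auto simp: u_def X'_def\<close>)
  moreover have "pdet (h(x := u)) (S - X) = pdet f (S - X)"
    by (rule pdet_cong) (use X in \<open>auto simp: h_def g_def X'_def\<close>)
  moreover have "pdet (h(x := v)) S = pdet (h(x := v)) (insert x (S - X)) * pdet (h(x := v)) X'"
    by (subst SX(2), rule pdet_block) (use S finX zero2 in \<open>auto simp: v_def X'_def\<close>)
  moreover have "pdet (h(x := v)) (insert x (S - X)) = pdet f (insert x (S - X))"
    by (rule pdet_cong) (auto simp: h_def g_def v_def X'_def)
  moreover have "pdet (h(x := v)) X = pdet (h(x := v)) {x} * pdet (h(x := v)) X'"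
    by (subst SX(3), rule pdet_block) (use finX in \<open>auto simp: v_def X'_def\<close>)
  moreover have "v x = f x x" by (simp add: v_def h_def g_def X'_def)
  moreover have "pdet h S = pdet f S" "pdet h X = pdet f X" using h_pdet S finX X by auto
  moreover have "x \<in> S" using X by auto
  ultimately have "pdet f X = pdet (h(x := u)) X + f x x * D"
    and "pdet f S = pdet (h(x := u)) X * pdet f (S - X) + pdet f (insert x (S - X)) * D"
    using split[OF finX X(2)] split[OF S] D by auto
  then show ?thesis by (simp add: algebra_simps)
qed

text \<open>The factor in \<open>pdet_clan\<close> is a determinant of differences. Applying that
  lemma to \<open>insert b X\<close> as well, where the minor on \<open>{x, b}\<close> is
  \<open>f x x * f b b - 1\<close>, expresses the factor by principal minors.\<close>

lemma pdet_clan_border: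
  assumes S: "finite S" and X: "X \<subseteq> S" "x \<in> X" and b: "b \<in> S - X"
    and out: "\<And>u y. u \<in> X \<Longrightarrow> y \<in> S - X \<Longrightarrow> f u y = f x y"
    and inn: "\<And>u y. u \<in> X \<Longrightarrow> y \<in> S - X \<Longrightarrow> f y u = f y x"
    and one: "f x b = 1" "f b x = 1"
  defines "D \<equiv> f b b * pdet f X - pdet f (insert b X)"
  shows "pdet f S = D * pdet f (insert x (S - X)) + (pdet f X - f x x * D) * pdet f (S - X)"
proof -
  have "finite (insert b X)" using S X by (auto intro: finite_subset)
  define E where "E = pdet (\<lambda>i k. f i k - f x k - (f i x - f x x)) (X - {x})"
  have "pdet f (insert b X) = E * pdet f (insert x (insert b X - X))
      + (pdet f X - f x x * E) * pdet f (insert b X - X)"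
    unfolding E_def
    by (rule pdet_clan[OF \<open>finite (insert b X)\<close> _ X(2)]) (use b out inn in blast)+
  moreover have "insert b X - X = {b}" using b by auto
  moreover have "pdet f {x, b} = f x x * f b b - 1"
    using b X one by (subst pdet_2) auto
  ultimately have "D = E" by (simp add: D_def algebra_simps)
  moreover have "pdet f S = E * pdet f (insert x (S - X)) + (pdet f X - f x x * E) * pdet f (S - X)"
    unfolding E_def by (rule pdet_clan[OF S X]) (use out inn in blast)+
  ultimately show ?thesis by simp
qed

section \<open>Permutation sums and library submatrices\<close>

lemma bij_betw_pick:
  assumes "finite S"
  shows "bij_betw (pick S) {0..<card S} S"
proof -
  have "inj_on (pick S) {0..<card S}"
    by (rule linorder_inj_onI) (auto dest: pick_mono_le)
  moreover have "pick S ` {0..<card S} \<subseteq> S" by (auto intro: pick_in_set_le)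
  ultimately show ?thesis using assms by (intro bij_betw_imageI card_subset_eq) (auto simp: card_image)
qed

lemma det_principal_submatrix:
  assumes "A \<in> carrier_mat n n" "S \<subseteq> {0..<n}"
  shows "det (principal_submatrix A S) = pdet (\<lambda>i k. A $$ (i, k)) S"
proof -
  have "{i. i < n \<and> i \<in> S} = S" using assms by auto
  then show ?thesis
    unfolding principal_submatrix_def submatrix_def
    using pdet_eq_det[OF bij_betw_pick, of S "\<lambda>i k. A $$ (i, k)"] assms
    by (auto dest: finite_subset)
qed



section \<open>The coloured graph of two normalised matrices\<close>

text \<open>For matrices \<open>F\<close> and \<open>G\<close> normalised at a base vertex, minors of order at most 3 force \<open>G\<close> to
  agree on each pair either with \<open>F\<close> (the pair is kept, or red) or with its transpose (flipped, or
  blue), unless \<open>F\<close> is symmetric there (neutral).\<close>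

definition neutral where "neutral F p q \<longleftrightarrow> F p q = F q p"
definition kept where "kept F G p q \<longleftrightarrow> F p q \<noteq> F q p \<and> G p q = F p q \<and> G q p = F q p"
definition flipped where "flipped F G p q \<longleftrightarrow> F p q \<noteq> F q p \<and> G p q = F q p \<and> G q p = F p q"
definition separates where
  "separates F x Y \<longleftrightarrow> (\<exists>u\<in>Y. \<exists>v\<in>Y. F u x \<noteq> F v x \<or> F x u \<noteq> F x v)"

text \<open>A list of successive splitters: \<open>derives V F Y xs\<close> says that \<open>xs\<close> lies in every
  clan of \<open>V\<close> that contains \<open>Y\<close>, with each element witnessed by the previous ones.\<close>

primrec derives where
  "derives V F Y [] = True"
| "derives V F Y (x # xs) = (x \<in> V \<and> x \<notin> Y \<and> separates F x Y \<and> derives V F (insert x Y) xs)"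

lemma kept_transpose: "kept (\<lambda>p q. F q p) (\<lambda>p q. G q p) = kept F G"
  and flipped_transpose: "flipped (\<lambda>p q. F q p) (\<lambda>p q. G q p) = flipped F G"
  and kept_swap: "kept F (\<lambda>p q. G q p) = flipped F G"
  and flipped_swap: "flipped F (\<lambda>p q. G q p) = kept F G"
  by (auto simp: fun_eq_iff kept_def flipped_def)

lemma separates_transpose: "separates (\<lambda>p q. F q p) = separates F"
  by (auto simp: fun_eq_iff separates_def)

lemma separates_mono: "separates F x Y \<Longrightarrow> Y \<subseteq> Z \<Longrightarrow> separates F x Z"
  unfolding separates_def by blast

text \<open>As \<open>x\<close> does not tell the elements of \<open>Y\<close> apart, the single
  element \<open>j\<close> can stand for all of them.\<close>

lemma separates_insert:
  assumes "\<not> separates F x Y" "j \<in> Y"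
  shows "separates F x (insert u Y) \<longleftrightarrow> F u x \<noteq> F j x \<or> F x u \<noteq> F x j"
proof
  have Y: "F w x = F j x" "F x w = F x j" if "w \<in> Y" for w
    using assms that unfolding separates_def by blast+
  assume "separates F x (insert u Y)"
  then obtain v w where "v \<in> insert u Y" "w \<in> insert u Y" "F v x \<noteq> F w x \<or> F x v \<noteq> F x w"
    unfolding separates_def by blast
  then show "F u x \<noteq> F j x \<or> F x u \<noteq> F x j"
    using Y[of v] Y[of w] by (metis insertE)
next
  assume "F u x \<noteq> F j x \<or> F x u \<noteq> F x j"
  then show "separates F x (insert u Y)" using assms(2) unfolding separates_def by blast
qed

lemma derives_transpose: "derives V (\<lambda>p q. F q p) Y xs = derives V F Y xs"
  by (induction xs arbitrary: Y) (simp_all add: separates_transpose[of F])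

lemma derives_append: "derives V F Y (xs @ ys) \<longleftrightarrow> derives V F Y xs \<and> derives V F (Y \<union> set xs) ys"
  by (induction xs arbitrary: Y) auto

lemma derives_set: "derives V F Y xs \<Longrightarrow> set xs \<subseteq> V \<and> set xs \<inter> Y = {} \<and> distinct xs"
  by (induction xs arbitrary: Y) auto

lemma derives_mono:
  "derives V F Y xs \<Longrightarrow> Y \<subseteq> Z \<Longrightarrow> Z \<inter> set xs = {} \<Longrightarrow> derives V F Z xs"
proof (induction xs arbitrary: Y Z)
  case (Cons x xs)
  have d: "derives V F (insert x Y) xs" using Cons.prems by simp
  then have "x \<notin> set xs" using derives_set[of V F "insert x Y" xs] by auto
  then have "derives V F (insert x Z) xs"
    using Cons.prems by (intro Cons.IH[OF d]) auto
  then show ?case using Cons.prems by (auto intro: separates_mono)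
qed simp

text \<open>\<open>cycle3\<close> and \<open>cycle4\<close> are the equalities of the minors on \<open>{p, q, r}\<close> and on \<open>{p, q, r}\<close>
  together with the base vertex. \<open>out_class\<close> and \<open>in_class\<close> are all that is used of property R:
  a rank-one cut separating \<open>u, v\<close> from \<open>i\<close> and the base vertex has \<open>y\<close> on one of its sides.\<close>

locale coloured =
  fixes V :: "'v set" and F G :: "'v \<Rightarrow> 'v \<Rightarrow> 'a::field"
  assumes nonzero: "\<lbrakk>p \<in> V; q \<in> V; p \<noteq> q\<rbrakk> \<Longrightarrow> F p q \<noteq> 0"
    and pair: "\<lbrakk>p \<in> V; q \<in> V; p \<noteq> q\<rbrakk> \<Longrightarrow>
      G p q = F p q \<and> G q p = F q p \<or> G p q = F q p \<and> G q p = F p q"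
    and cycle3: "\<lbrakk>p \<in> V; q \<in> V; r \<in> V; distinct [p, q, r]\<rbrakk> \<Longrightarrow>
      F p q * F q r * F r p + F p r * F r q * F q p = G p q * G q r * G r p + G p r * G r q * G q p"
    and cycle4: "\<lbrakk>p \<in> V; q \<in> V; r \<in> V; distinct [p, q, r]\<rbrakk> \<Longrightarrow>
      F p q * F q r + F p r * F r q + F q p * F p r + F q r * F r p + F r p * F p q + F r q * F q p =
      G p q * G q r + G p r * G r q + G q p * G p r + G q r * G r p + G r p * G p q + G r q * G q p"
    and out_class: "\<lbrakk>i \<in> V; u \<in> V; v \<in> V; y \<in> V; i \<noteq> u; i \<noteq> v; i \<noteq> y; u \<noteq> v; u \<noteq> y; v \<noteq> y; F u i = F v i\<rbrakk> \<Longrightarrow>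
      F u y = F v y \<or> F y i = F u i"
    and in_class: "\<lbrakk>i \<in> V; u \<in> V; v \<in> V; y \<in> V; i \<noteq> u; i \<noteq> v; i \<noteq> y; u \<noteq> v; u \<noteq> y; v \<noteq> y; F i u = F i v\<rbrakk> \<Longrightarrow>
      F y u = F y v \<or> F i y = F i u"
begin

abbreviation neut where "neut \<equiv> neutral F"
abbreviation red where "red \<equiv> kept F G"
abbreviation blue where "blue \<equiv> flipped F G"

lemma colours: "\<lbrakk>p \<in> V; q \<in> V; p \<noteq> q\<rbrakk> \<Longrightarrow> neut p q \<or> red p q \<or> blue p q"
  using pair[of p q] unfolding neutral_def kept_def flipped_def by metis

lemma neut_commute: "neut p q \<longleftrightarrow> neut q p" by (auto simp: neutral_def)
lemma red_commute: "red p q \<longleftrightarrow> red q p" by (auto simp: kept_def)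
lemma blue_commute: "blue p q \<longleftrightarrow> blue q p" by (auto simp: flipped_def)

lemma coloured_transpose: "coloured V (\<lambda>p q. F q p) (\<lambda>p q. G q p)"
proof
  fix p q r assume *: "p \<in> V" "q \<in> V" "r \<in> V" "distinct [p, q, r]"
  show "F q p * F r q * F p r + F r p * F q r * F p q = G q p * G r q * G p r + G r p * G q r * G p q"
    using cycle3[OF *] by (simp add: algebra_simps)
  show "F q p * F r q + F r p * F q r + F p q * F r p + F r q * F p r + F p r * F q p + F q r * F p q =
      G q p * G r q + G r p * G q r + G p q * G r p + G r q * G p r + G p r * G q p + G q r * G p q"
    using cycle4[OF *] by (simp add: algebra_simps)
next
  show "F y u = F y v \<or> F i y = F i u"
    if "i \<in> V" "u \<in> V" "v \<in> V" "y \<in> V" "i \<noteq> u" "i \<noteq> v" "i \<noteq> y" "u \<noteq> v" "u \<noteq> y" "v \<noteq> y" "F i u = F i v" for i u v y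
    by (rule in_class[OF that])
  show "F u y = F v y \<or> F y i = F u i"
    if "i \<in> V" "u \<in> V" "v \<in> V" "y \<in> V" "i \<noteq> u" "i \<noteq> v" "i \<noteq> y" "u \<noteq> v" "u \<noteq> y" "v \<noteq> y" "F u i = F v i" for i u v y
    by (rule out_class[OF that])
qed (use nonzero pair in blast)+

text \<open>Transposing \<open>G\<close> alone exchanges red and blue, so every statement about
  colours also holds with the colours reversed.\<close>

lemma coloured_swap: "coloured V F (\<lambda>p q. G q p)"
proof
  fix p q r assume *: "p \<in> V" "q \<in> V" "r \<in> V" "distinct [p, q, r]"
  show "F p q * F q r * F r p + F p r * F r q * F q p = G q p * G r q * G p r + G r p * G q r * G p q"
    using cycle3[OF *] by (simp add: algebra_simps)
  show "F p q * F q r + F p r * F r q + F q p * F p r + F q r * F r p + F r p * F p q + F r q * F q p =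
      G q p * G r q + G r p * G q r + G p q * G r p + G r q * G p r + G p r * G q p + G q r * G p q"
    using cycle4[OF *] by (simp add: algebra_simps)
next
  show "F y u = F y v \<or> F i y = F i u"
    if "i \<in> V" "u \<in> V" "v \<in> V" "y \<in> V" "i \<noteq> u" "i \<noteq> v" "i \<noteq> y" "u \<noteq> v" "u \<noteq> y" "v \<noteq> y" "F i u = F i v" for i u v y
    by (rule in_class[OF that])
  show "F u y = F v y \<or> F y i = F u i"
    if "i \<in> V" "u \<in> V" "v \<in> V" "y \<in> V" "i \<noteq> u" "i \<noteq> v" "i \<noteq> y" "u \<noteq> v" "u \<noteq> y" "v \<noteq> y" "F u i = F v i" for i u v y
    by (rule out_class[OF that])
qed (use nonzero pair in blast)+

text \<open>With a neutral edge \<open>p r\<close>, the difference of the two sides of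
  \<open>cycle3\<close> factors into \<open>F p r\<close> and the asymmetries of \<open>p q\<close>
  and \<open>q r\<close>, none of which vanishes.\<close>

lemma no_rainbow:
  assumes V: "p \<in> V" "q \<in> V" "r \<in> V" "p \<noteq> q" "p \<noteq> r" "q \<noteq> r" and c: "red p q" "blue q r"
  shows "\<not> neut p r"
proof
  assume s: "neut p r"
  have "F p q * F q r * F r p + F p r * F r q * F q p = G p q * G q r * G r p + G p r * G r q * G q p"
    using cycle3[of p q r] V by simp
  moreover have "G p r = F p r" "G r p = F p r" "F r p = F p r"
    using pair[of p r] s V by (auto simp: neutral_def)
  ultimately have "F p r * ((F p q - F q p) * (F q r - F r q)) = 0"
    using c by (simp add: kept_def flipped_def algebra_simps)
  then show False
    using nonzero[of p r] V c by (simp add: kept_def flipped_def)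
qed

text \<open>The differences in \<open>cycle3\<close> and \<open>cycle4\<close> are both divisible by
  \<open>F q r - F r q\<close>. What remains says that \<open>F p q, F r p\<close> and
  \<open>F p r, F q p\<close> have the same product and the same sum; as \<open>F p q\<close>
  differs from \<open>F q p\<close>, it must equal \<open>F p r\<close>.\<close>

lemma twins_red:
  assumes V: "p \<in> V" "q \<in> V" "r \<in> V" "p \<noteq> q" "p \<noteq> r" "q \<noteq> r"
    and c: "red p q" "red p r" "blue q r"
  shows "F p q = F p r" "F q p = F r p"
proof -
  have d: "distinct [p, q, r]" using V by simp
  have "(F q r - F r q) * (F p q * F r p - F p r * F q p) = 0"
    using cycle3[OF V(1-3) d] c by (simp add: kept_def flipped_def algebra_simps)
  then have prod: "F p q * F r p = F p r * F q p"
    using c by (simp add: flipped_def)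
  have "(F q r - F r q) * (F p q + F r p - (F p r + F q p)) = 0"
    using cycle4[OF V(1-3) d] c by (simp add: kept_def flipped_def algebra_simps)
  then have sum: "F p q + F r p = F p r + F q p"
    using c by (simp add: flipped_def)
  then have rp: "F r p = F p r + F q p - F p q" by (simp add: algebra_simps)
  have "(F p q - F p r) * (F p q - F q p) = 0"
    using prod unfolding rp by (simp add: algebra_simps)
  then show "F p q = F p r" using c by (simp add: kept_def)
  then show "F q p = F r p" using sum by simp
qed

lemma twins_blue:
  assumes "p \<in> V" "q \<in> V" "r \<in> V" "p \<noteq> q" "p \<noteq> r" "q \<noteq> r" "blue p q" "blue p r" "red q r"
  shows "F p q = F p r" "F q p = F r p"
proof -
  interpret swap: coloured V F "\<lambda>p q. G q p" by (rule coloured_swap)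
  have "swap.red = blue" "swap.blue = red"
    by (rule kept_swap, rule flipped_swap)
  then show "F p q = F p r" "F q p = F r p" using swap.twins_red[OF assms(1-6)] assms by simp_all
qed

text \<open>By \<open>no_rainbow\<close> the third edge is coloured. Whichever its colour, two edges
  of equal colour meet at \<open>j\<close> or at \<open>x\<close>, and the twin lemma applies
  there.\<close>

lemma chain_red_blue:
  assumes V: "i \<in> V" "j \<in> V" "x \<in> V" "i \<noteq> j" "i \<noteq> x" "j \<noteq> x" and c: "red i j" "blue i x"
  shows "red x j \<and> F j i = F j x \<and> F i j = F x j \<or> blue x j \<and> F x i = F x j \<and> F i x = F j x"
proof -
  have "\<not> neut j x"
    using no_rainbow[of j i x] V c red_commute[of i j] by metis
  moreover have "F j i = F j x \<and> F i j = F x j" if "red x j"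
    using twins_red[of j i x] V c that red_commute by metis
  moreover have "F x i = F x j \<and> F i x = F j x" if "blue x j"
    using twins_blue[of x i j] V c that blue_commute by metis
  ultimately show ?thesis
    using colours[of x j] V neut_commute[of x j] by metis
qed

text \<open>Here \<open>x\<close> tells \<open>j\<close> and \<open>k\<close> apart in one direction
  only. \<open>in_class\<close> turns this into \<open>F i x = F i j\<close>; were the equality in
  the other direction to fail, every colouring of the edges at \<open>x\<close> would be
  contradictory.\<close>

lemma split_imp_out:
  assumes V: "i \<in> V" "j \<in> V" "k \<in> V" "x \<in> V" "i \<noteq> j" "i \<noteq> k" "i \<noteq> x" "j \<noteq> k" "j \<noteq> x" "k \<noteq> x"
    and c: "red i j" "red i k" "blue j k" and s: "F j x = F k x" "F x j \<noteq> F x k"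
  shows "F i x = F i j \<and> F x i = F j i"
proof -
  have ij: "F i j = F i k" "F j i = F k i" using twins_red[of i j k] V c by metis+
  have asym: "F i j \<noteq> F j i" using c by (simp add: kept_def)
  have ix: "F i x = F i j" using in_class[of i j k x] V ij s by metis
  have "F x i = F j i"
  proof (rule ccontr)
    assume ne: "F x i \<noteq> F j i"
    have bjk: "blue k j" using c by (simp add: blue_commute)
    have rr: "\<not> (red x j \<and> red x k)"
      using twins_red[of x j k] V c s by metis
    have nn: "\<not> (neut x j \<and> neut x k)"
      using s by (metis neutral_def)
    have rn: "\<not> (red x j \<and> neut x k)" "\<not> (neut x j \<and> red x k)"
      using no_rainbow[of x j k] no_rainbow[of x k j] c bjk V by metis+
    have not_twin: "\<not> (red i x \<and> blue x l)" if "l = j \<or> l = k" for l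
      using twins_red[of i x l] that V c ne ij by metis
    have N: "\<not> (neut i x \<and> blue x l)" if "l = j \<or> l = k" for l
      using no_rainbow[of i l x] blue_commute[of x l] that V c by metis
    \<comment> \<open>If \<open>i x\<close> were red or neutral, neither \<open>x j\<close> nor
      \<open>x k\<close> could be blue, and the remaining colourings of these two edges are excluded
      by \<open>rr\<close>, \<open>nn\<close> and \<open>rn\<close>.\<close>
    have "blue i x"
    proof (rule ccontr)
      assume "\<not> blue i x"
      then have "red i x \<or> neut i x" using colours[of i x] V by metis
      then have "\<not> blue x j" "\<not> blue x k" using not_twin N by blast+
      then have "red x j \<or> neut x j" "red x k \<or> neut x k"
        using colours[of x j] colours[of x k] V by metis+
      then show False using rr nn rn by blast
    qed
    then show False
      using chain_red_blue[of i j x] chain_red_blue[of i k x] V c ij ix s asym by metis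
  qed
  then show ?thesis using ix by simp
qed

text \<open>A vertex that splits \<open>{j, k}\<close> looks to \<open>i\<close> exactly like
  \<open>j\<close> and \<open>k\<close>. Hence one splitter alone never leads to \<open>i\<close>: a
  derivation of \<open>i\<close> has at least two earlier elements.\<close>

lemma splitter_twin_red:
  assumes V: "i \<in> V" "j \<in> V" "k \<in> V" "x \<in> V" "i \<noteq> j" "i \<noteq> k" "i \<noteq> x" "j \<noteq> k" "j \<noteq> x" "k \<noteq> x"
    and c: "red i j" "red i k" "blue j k" and s: "F j x \<noteq> F k x \<or> F x j \<noteq> F x k"
  shows "F i x = F i j \<and> F x i = F j i"
proof -
  interpret tr: coloured V "\<lambda>p q. F q p" "\<lambda>p q. G q p" by (rule coloured_transpose)
  have "tr.red p q = red p q" "tr.blue p q = blue p q" for p q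
    by (simp_all add: kept_transpose[of F G] flipped_transpose[of F G])
  then have tr: "F x i = F j i \<and> F i x = F i j" if "F x j = F x k" "F j x \<noteq> F k x"
    using tr.split_imp_out[OF V] that c by simp
  have ij: "F i j = F i k" "F j i = F k i" using twins_red[of i j k] V c by metis+
  show ?thesis
    using split_imp_out[OF V c] tr in_class[of i j k x] out_class[of i j k x] V ij s by metis
qed

section \<open>Final steps of a shortest derivation\<close>

abbreviation splits where "splits \<equiv> separates F"

text \<open>The last three steps \<open>x, y, i\<close> of a shortest derivation of \<open>i\<close> from \<open>{j, k}\<close>.\<close>

lemma last_steps:
  assumes Y: "Y \<subseteq> V" "j \<in> Y" "k \<in> Y" "j \<noteq> k"
    and V: "i \<in> V" "x \<in> V" "y \<in> V" "i \<notin> Y" "x \<notin> Y" "y \<notin> Y" "distinct [i, x, y]"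
    and c: "red i j" "red i k" "blue j k"
    and i: "\<not> splits i (insert x Y)" and y: "\<not> splits y Y" "splits y (insert x Y)"
    and yi: "F y i \<noteq> F j i"
  shows "\<And>w. w \<in> Y \<Longrightarrow> F x w = F x j"
    and "\<And>w. w \<in> Y \<Longrightarrow> red i x \<Longrightarrow> red i w \<Longrightarrow> \<not> blue x w"
proof -
  have d: "i \<noteq> x" "i \<noteq> y" "x \<noteq> y" using V by auto
  have jV: "j \<in> V" using Y by auto
  have iw: "F i w = F i j" "F w i = F j i" if "w \<in> insert x Y" for w
    using i Y that unfolding separates_def by blast+
  have yw: "F y w = F y j" "F w y = F j y" if "w \<in> Y" for w
    using y Y that unfolding separates_def by blast+
  \<comment> \<open>As \<open>F y i\<close> differs from the common value
    \<open>F x i = F j i\<close>, \<open>out_class\<close> leaves only this equality. So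
    \<open>y\<close> tells \<open>x\<close> from \<open>j\<close> through its row alone.\<close>
  have "F x y = F j y"
    using out_class[of i x j y] V(1-6) d Y yi iw[of x] jV by (metis insertI1)
  then have yx: "F y x \<noteq> F y j"
    using y(2) separates_insert[OF y(1) Y(2)] by auto
  show "F x w = F x j" if "w \<in> Y" for w
    using in_class[of y w j x] V(2,3,5,6) d Y(1,2) jV yw[OF that] yx that by (metis subsetD)
  show "\<not> blue x w" if "w \<in> Y" "red i x" "red i w" for w
    using splitter_twin_red[of i x w y] V(1-6) d Y(1) that yw[OF that(1)] yx yi iw[of x]
    by (metis insertI1 subsetD)
qed

text \<open>The case in which no vertex precedes \<open>x\<close>. By \<open>last_steps\<close> the
  splitting of \<open>j, k\<close> by \<open>x\<close> shows only in \<open>F j x\<close> and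
  \<open>F k x\<close>; each colour of \<open>i x\<close> then contradicts a triangle lemma.\<close>

lemma no_derivation_3:
  assumes V: "i \<in> V" "j \<in> V" "k \<in> V" "x \<in> V" "y \<in> V" "distinct [i, j, k, x, y]"
    and c: "red i j" "red i k" "blue j k"
    and i: "\<not> splits i {x, j, k}" and y: "\<not> splits y {j, k}" "splits y {x, j, k}"
    and x: "splits x {j, k}" and yi: "F y i \<noteq> F j i"
  shows False
proof -
  note ls = last_steps[of "{j, k}" j k i x y]
  have xk: "F x k = F x j" using ls(1)[of k] assms by auto
  then have jk: "F j x \<noteq> F k x" using x unfolding separates_def by auto
  have iw: "F i w = F i j" "F w i = F j i" if "w \<in> {x, j, k}" for w
    using i that unfolding separates_def by blast+
  have asym: "F i j \<noteq> F j i" using c by (simp add: kept_def)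
  have d: "i \<noteq> j" "i \<noteq> k" "i \<noteq> x" "j \<noteq> k" "j \<noteq> x" "k \<noteq> x" using V by auto
  have "\<not> neut i x" using iw[of x] asym by (simp add: neutral_def)
  then consider "red i x" | "blue i x" using colours[of i x] V(1,4) d by metis
  then show False
  proof cases
    case 1
    have nb: "\<not> blue x j" "\<not> blue x k" using ls(2)[of j] ls(2)[of k] 1 assms by auto
    have bkj: "blue k j" using c by (simp add: blue_commute)
    have "\<not> (neut x j \<and> neut x k)" using jk xk by (metis neutral_def)
    moreover have "\<not> (red x j \<and> neut x k)" "\<not> (red x k \<and> neut x j)"
      using no_rainbow[of x j k] no_rainbow[of x k j] c bkj V(1-5) d by metis+
    moreover have "\<not> (red x j \<and> red x k)"
      using twins_red[of x j k] V(1-5) d c jk by metis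
    ultimately show False using nb colours[of x j] colours[of x k] V(1-5) d by metis
  next
    case 2
    then show False
      using chain_red_blue[of i j x] chain_red_blue[of i k x] V(1-5) d c iw[of x] iw[of j] iw[of k]
        xk jk asym by (metis insertCI)
  qed
qed

text \<open>In the first two outcomes \<open>x\<close> is the apex of another bad triangle: over
  \<open>j, k\<close>, or with colours exchanged over \<open>i, j\<close> or \<open>i, k\<close>.
  The third is impossible when \<open>x\<close> does not split \<open>{j, k}\<close>.\<close>

lemma blue_edge_cases:
  assumes V: "i \<in> V" "j \<in> V" "k \<in> V" "x \<in> V" "i \<noteq> j" "i \<noteq> k" "i \<noteq> x" "j \<noteq> k" "j \<noteq> x" "k \<noteq> x"
    and c: "red i j" "red i k" "blue j k" "blue i x"
    and ij: "F i k = F i j" "F k i = F j i" "F i x = F i j" "F x i = F j i"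
  shows "red x j \<and> red x k \<or> blue x j \<and> blue x k \<or>
    splits x {j, k} \<and> (red x j \<and> blue x k \<or> blue x j \<and> red x k)"
proof -
  have "F i j \<noteq> F j i" using c by (simp add: kept_def)
  moreover have "splits x {j, k}" if "F x j \<noteq> F x k" using that unfolding separates_def by blast
  ultimately show ?thesis
    using chain_red_blue[of i j x] chain_red_blue[of i k x] V c ij by metis
qed

text \<open>The derivation ends in \<open>u, x, y, i\<close>, and \<open>ih\<close> collects what
  shorter derivations exclude. The surviving configuration is the one in which moving the base to
  \<open>x\<close> makes \<open>u\<close> red to \<open>j\<close> and \<open>k\<close>.\<close>

lemma derivation_tail:
  assumes Y: "Y \<subseteq> V" "j \<in> Y" "k \<in> Y" "j \<noteq> k"
    and V: "i \<in> V" "u \<in> V" "x \<in> V" "y \<in> V" "i \<notin> Y" "u \<notin> Y" "x \<notin> Y" "y \<notin> Y" "distinct [i, u, x, y]"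
    and c: "red i j" "red i k" "blue j k"
    and i: "\<not> splits i (insert x (insert u Y))"
    and y: "\<not> splits y (insert u Y)" "splits y (insert x (insert u Y))"
    and x: "\<not> splits x Y" "splits x (insert u Y)"
    and yi: "F y i \<noteq> F j i"
    and ih: "\<not> (red x j \<and> red x k)" "\<not> (red u j \<and> red u k)"
      "\<not> (blue x i \<and> blue x j \<and> blue x k)" "\<not> (blue u i \<and> blue u j \<and> blue u k)"
  shows "\<And>w. w \<in> Y \<Longrightarrow> F x w = F x j \<and> F w x = F x j"
    and "F x u = F x j" "red x u" "neut u j" "neut u k"
proof -
  have ls: "\<And>w. w \<in> insert u Y \<Longrightarrow> F x w = F x j"
    "\<And>w. w \<in> insert u Y \<Longrightarrow> red i x \<Longrightarrow> red i w \<Longrightarrow> \<not> blue x w"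
    using last_steps[of "insert u Y" j k i x y] assms by auto
  show xu: "F x u = F x j" using ls by simp
  have xw: "F x w = F x j" "F w x = F j x" if "w \<in> Y" for w
    using x(1) Y that unfolding separates_def by blast+
  have ux: "F u x \<noteq> F j x" using x(2) separates_insert[OF x(1) Y(2)] xu by auto
  have iw: "F i w = F i j" "F w i = F j i" if "w \<in> insert x (insert u Y)" for w
    using i Y that unfolding separates_def by blast+
  have V': "j \<in> V" "k \<in> V" "i \<in> V" "u \<in> V" "x \<in> V" using Y V by auto
  have d: "i \<noteq> j" "i \<noteq> k" "i \<noteq> u" "i \<noteq> x" "j \<noteq> k" "j \<noteq> u" "j \<noteq> x" "k \<noteq> u" "k \<noteq> x" "u \<noteq> x"
    using Y V by auto
  have asym: "F i j \<noteq> F j i" using c by (simp add: kept_def)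
  have iv: "F i k = F i j" "F k i = F j i" "F i x = F i j" "F x i = F j i" "F i u = F i j" "F u i = F j i"
    using iw[of k] iw[of x] iw[of u] Y by simp_all
  have nneut: "\<not> neut i x" "\<not> neut i u" using iv asym by (simp_all add: neutral_def)
  have nsplit: "\<not> splits x {j, k}" using x(1) Y separates_mono[of F x "{j, k}" Y] by auto
  have bkj: "blue k j" using c by (simp add: blue_commute)
  have "\<not> blue i x"
    using blue_edge_cases[of i j k x] V' d c iv nsplit ih blue_commute[of i x] by metis
  then have ix: "red i x" using colours[of i x] V' d nneut by metis
  have nb: "\<not> blue x j" "\<not> blue x k" using ls(2) ix c Y by auto
  have "neut x j"
  proof (rule ccontr)
    assume "\<not> neut x j"
    then have xj: "red x j" using colours[of x j] V' d nb by metis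
    then have "\<not> neut x k" using no_rainbow[of x j k] V' d c by metis
    then have "red x k" using colours[of x k] V' d nb by metis
    then show False using xj ih(1) by metis
  qed
  then have jx: "F j x = F x j" by (simp add: neutral_def)
  then show "F x w = F x j \<and> F w x = F x j" if "w \<in> Y" for w using xw[OF that] by metis
  have sxk: "neut x k" using xw[OF Y(3)] jx by (metis neutral_def)
  have nsxu: "\<not> neut x u" using ux xu jx by (metis neutral_def)
  \<comment> \<open>As \<open>x\<close> is neutral to \<open>j\<close> and \<open>k\<close>,
    differently coloured edges from \<open>u\<close> to \<open>x\<close> and to one of them would
    contradict \<open>no_rainbow\<close>.\<close>
  have same: "blue x u \<Longrightarrow> \<not> red u l" "red x u \<Longrightarrow> \<not> blue u l" if "l = j \<or> l = k" for l
    using no_rainbow[of l u x] no_rainbow[of x u l] that V' d \<open>neut x j\<close> sxk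
    by (metis red_commute blue_commute neut_commute)+
  have "\<not> blue i u"
  proof
    assume b: "blue i u"
    have "red x u \<or> blue x u" using colours[of x u] V' d nsxu by metis
    then show False
      using blue_edge_cases[of i j k u] V' d c iv ih same[of j] same[of k] b blue_commute[of i u]
      by metis
  qed
  then have iu: "red i u" using colours[of i u] V' d nneut by metis
  then have "\<not> blue x u" using ls(2)[of u] ix by simp
  then show rxu: "red x u" using colours[of x u] V' d nsxu by metis
  have nbu: "\<not> blue u j" "\<not> blue u k" using same rxu by metis+
  have "\<not> (red u j \<and> neut u k)" "\<not> (neut u j \<and> red u k)" "\<not> (red u j \<and> red u k)"
    using no_rainbow[of u j k] no_rainbow[of u k j] V' d c bkj ih(2) by metis+
  then show "neut u j" "neut u k"
    using nbu colours[of u j] colours[of u k] V' d by metis+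
qed

end

section \<open>Normalisation at a base vertex\<close>

text \<open>Row \<open>p\<close> is divided by \<open>f p b\<close> and column \<open>q\<close> by
  \<open>f b q\<close>, for indices other than \<open>b\<close>. The border is set to 1 outright, so
  that it is constant without assuming nonzero entries, and \<open>f b b\<close> is kept.\<close>

definition nrm :: "'v \<Rightarrow> ('v \<Rightarrow> 'v \<Rightarrow> 'a::field) \<Rightarrow> 'v \<Rightarrow> 'v \<Rightarrow> 'a" where
  "nrm b f p q = (if p = b then if q = b then f b b else 1
    else if q = b then 1 else f p q / (f p b * f b q))"

lemma nrm_transpose: "nrm b (\<lambda>p q. f q p) = (\<lambda>p q. nrm b f q p)"
  by (auto simp: nrm_def fun_eq_iff mult.commute)

lemma pair_of_sum_prod:
  fixes x y z w :: "'a::idom"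
  assumes "x + y = z + w" "x * y = z * w"
  shows "z = x \<and> w = y \<or> z = y \<and> w = x"
proof -
  have w: "w = x + y - z" using assms(1) by (simp add: algebra_simps)
  have "(z - x) * (z - y) = 0" using assms(2) unfolding w by (simp add: algebra_simps)
  then show ?thesis using w by auto
qed

text \<open>The cycle sums express equality of the minors up to order 4 once the diagonal and the
  shorter cycles have been cancelled. \<open>outc\<close> and \<open>inc\<close> are
  \<open>out_class\<close> and \<open>in_class\<close> before normalisation, for every base at once,
  because the base will be moved.\<close>

locale minors =
  fixes U :: "'v set" and f g :: "'v \<Rightarrow> 'v \<Rightarrow> 'a::field"
  assumes nz: "\<lbrakk>p \<in> U; q \<in> U; p \<noteq> q\<rbrakk> \<Longrightarrow> f p q \<noteq> 0 \<and> g p q \<noteq> 0"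
    and diag: "p \<in> U \<Longrightarrow> f p p = g p p"
    and cyc2: "\<lbrakk>p \<in> U; q \<in> U; p \<noteq> q\<rbrakk> \<Longrightarrow> f p q * f q p = g p q * g q p"
    and cyc3: "\<lbrakk>p \<in> U; q \<in> U; r \<in> U; distinct [p, q, r]\<rbrakk> \<Longrightarrow>
      f p q * f q r * f r p + f p r * f r q * f q p = g p q * g q r * g r p + g p r * g r q * g q p"
    and cyc4: "\<lbrakk>b \<in> U; p \<in> U; q \<in> U; r \<in> U; distinct [b, p, q, r]\<rbrakk> \<Longrightarrow>
      f b p * f p q * f q r * f r b + f b p * f p r * f r q * f q b + f b q * f q p * f p r * f r b
      + f b q * f q r * f r p * f p b + f b r * f r p * f p q * f q b + f b r * f r q * f q p * f p b =
      g b p * g p q * g q r * g r b + g b p * g p r * g r q * g q b + g b q * g q p * g p r * g r b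
      + g b q * g q r * g r p * g p b + g b r * g r p * g p q * g q b + g b r * g r q * g q p * g p b"
    and outc: "\<lbrakk>b \<in> U; i \<in> U; u \<in> U; v \<in> U; y \<in> U; distinct [b, i, u, v, y];
        f u i * f v b = f v i * f u b\<rbrakk> \<Longrightarrow>
      f u y * f v b = f v y * f u b \<or> f y i * f u b = f u i * f y b"
    and inc: "\<lbrakk>b \<in> U; i \<in> U; u \<in> U; v \<in> U; y \<in> U; distinct [b, i, u, v, y];
        f i u * f b v = f i v * f b u\<rbrakk> \<Longrightarrow>
      f y u * f b v = f y v * f b u \<or> f i y * f b u = f i u * f b y"
begin

text \<open>By \<open>cyc2\<close> the numbers \<open>P p\<close> belong to both matrices, and
  multiplying by them clears denominators. The 3-cycles through \<open>b\<close> give the sum and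
  the 2-cycles the product of the two entries of a pair, which settles \<open>pair\<close>;
  \<open>cycle3\<close> and \<open>cycle4\<close> come from 3-cycles avoiding \<open>b\<close> and
  4-cycles through \<open>b\<close>.\<close>

lemma coloured_nrm:
  assumes b: "b \<in> U"
  shows "coloured (U - {b}) (nrm b f) (nrm b g)"
proof -
  have n: "f p b \<noteq> 0" "f b p \<noteq> 0" "g p b \<noteq> 0" "g b p \<noteq> 0" if "p \<in> U - {b}" for p
    using nz[of p b] nz[of b p] b that by auto
  have gg: "f p b * f b p = g p b * g b p" if "p \<in> U - {b}" for p
    using cyc2[of p b] b that by auto
  have F: "f p q = nrm b f p q * f p b * f b q" if "p \<in> U - {b}" "q \<in> U - {b}" for p q
    using n that by (simp add: nrm_def)
  have G: "g p q = nrm b g p q * g p b * g b q" if "p \<in> U - {b}" "q \<in> U - {b}" for p q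
    using n that by (simp add: nrm_def)
  define P where "P p = f p b * f b p" for p
  have P: "P p \<noteq> 0" if "p \<in> U - {b}" for p using n that by (simp add: P_def)
  have gP: "g p b * g b p = P p" if "p \<in> U - {b}" for p using gg that by (simp add: P_def)
  show ?thesis
  proof
    fix p q assume pq: "p \<in> U - {b}" "q \<in> U - {b}" "p \<noteq> q"
    show "nrm b f p q \<noteq> 0" using pq n nz[of p q] by (auto simp: nrm_def)
    have 3: "f b p * f p q * f q b + f b q * f q p * f p b = g b p * g p q * g q b + g b q * g q p * g p b"
      using cyc3[of b p q] pq b by auto
    have "P p * P q * (nrm b f p q + nrm b f q p) = P p * P q * (nrm b g p q + nrm b g q p)"
    proof -
      have "P p * P q * (nrm b f p q + nrm b f q p) = f b p * f p q * f q b + f b q * f q p * f p b"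
        unfolding F[OF pq(1,2)] F[OF pq(2,1)] P_def by (simp add: algebra_simps)
      moreover have "(g p b * g b p) * (g q b * g b q) * (nrm b g p q + nrm b g q p)
          = g b p * g p q * g q b + g b q * g q p * g p b"
        unfolding G[OF pq(1,2)] G[OF pq(2,1)] by (simp add: algebra_simps)
      ultimately show ?thesis using 3 pq gP by simp
    qed
    then have sum: "nrm b f p q + nrm b f q p = nrm b g p q + nrm b g q p" using P pq by simp
    have "P p * P q * (nrm b f p q * nrm b f q p) = P p * P q * (nrm b g p q * nrm b g q p)"
    proof -
      have "P p * P q * (nrm b f p q * nrm b f q p) = f p q * f q p"
        unfolding F[OF pq(1,2)] F[OF pq(2,1)] P_def by (simp add: algebra_simps)
      moreover have "(g p b * g b p) * (g q b * g b q) * (nrm b g p q * nrm b g q p) = g p q * g q p"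
        unfolding G[OF pq(1,2)] G[OF pq(2,1)] by (simp add: algebra_simps)
      ultimately show ?thesis using cyc2[of p q] pq gP by simp
    qed
    then have "nrm b f p q * nrm b f q p = nrm b g p q * nrm b g q p" using P pq by simp
    from pair_of_sum_prod[OF sum this]
    show "nrm b g p q = nrm b f p q \<and> nrm b g q p = nrm b f q p \<or>
      nrm b g p q = nrm b f q p \<and> nrm b g q p = nrm b f p q" .
  next
    fix p q r assume *: "p \<in> U - {b}" "q \<in> U - {b}" "r \<in> U - {b}" "distinct [p, q, r]"
    let ?C3 = "\<lambda>F. F p q * F q r * F r p + F p r * F r q * F q p"
    let ?C4 = "\<lambda>F. F p q * F q r + F p r * F r q + F q p * F p r + F q r * F r p + F r p * F p q + F r q * F q p"
    let ?D4 = "\<lambda>f. f b p * f p q * f q r * f r b + f b p * f p r * f r q * f q b + f b q * f q p * f p r * f r b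
      + f b q * f q r * f r p * f p b + f b r * f r p * f p q * f q b + f b r * f r q * f q p * f p b"
    note F' = F[OF *(1) *(2)] F[OF *(2) *(1)] F[OF *(1) *(3)] F[OF *(3) *(1)] F[OF *(2) *(3)] F[OF *(3) *(2)]
    note G' = G[OF *(1) *(2)] G[OF *(2) *(1)] G[OF *(1) *(3)] G[OF *(3) *(1)] G[OF *(2) *(3)] G[OF *(3) *(2)]
    have P0: "P p * P q * P r \<noteq> 0" using P * by simp
    have "P p * P q * P r * ?C3 (nrm b f) = ?C3 f" "P p * P q * P r * ?C4 (nrm b f) = ?D4 f"
      unfolding F' P_def by (simp_all add: algebra_simps)
    moreover have "(g p b * g b p) * (g q b * g b q) * (g r b * g b r) * ?C3 (nrm b g) = ?C3 g"
      "(g p b * g b p) * (g q b * g b q) * (g r b * g b r) * ?C4 (nrm b g) = ?D4 g"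
      unfolding G' by (simp_all add: algebra_simps)
    moreover have "?C3 f = ?C3 g" using cyc3[of p q r] * by blast
    moreover have "?D4 f = ?D4 g" using cyc4[of b p q r] * b by auto
    ultimately have "P p * P q * P r * ?C3 (nrm b f) = P p * P q * P r * ?C3 (nrm b g)"
      "P p * P q * P r * ?C4 (nrm b f) = P p * P q * P r * ?C4 (nrm b g)"
      using gP * by metis+
    then show "?C3 (nrm b f) = ?C3 (nrm b g)" "?C4 (nrm b f) = ?C4 (nrm b g)"
      using P0 mult_left_cancel by blast+
  next
    fix i u v y
    assume V: "i \<in> U - {b}" "u \<in> U - {b}" "v \<in> U - {b}" "y \<in> U - {b}"
      and d: "i \<noteq> u" "i \<noteq> v" "i \<noteq> y" "u \<noteq> v" "u \<noteq> y" "v \<noteq> y"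
    have out: "nrm b f p q = nrm b f r q \<longleftrightarrow> f p q * f r b = f r q * f p b"
      if "p \<in> U - {b}" "q \<in> U - {b}" "r \<in> U - {b}" for p q r
      using that n by (simp add: nrm_def field_simps)
    have inn: "nrm b f q p = nrm b f q r \<longleftrightarrow> f q p * f b r = f q r * f b p"
      if "p \<in> U - {b}" "q \<in> U - {b}" "r \<in> U - {b}" for p q r
      using that n by (simp add: nrm_def field_simps)
    have d': "distinct [b, i, u, v, y]" using V d by auto
    show "nrm b f u y = nrm b f v y \<or> nrm b f y i = nrm b f u i" if "nrm b f u i = nrm b f v i"
      using outc[OF b _ _ _ _ d'] V that by (simp add: out)
    show "nrm b f y u = nrm b f y v \<or> nrm b f i y = nrm b f i u" if "nrm b f i u = nrm b f i v"
      using inc[OF b _ _ _ _ d'] V that by (simp add: inn)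
  qed
qed

lemma minors_transpose: "minors U (\<lambda>p q. f q p) (\<lambda>p q. g q p)"
proof
  fix p q r assume *: "p \<in> U" "q \<in> U" "r \<in> U" "distinct [p, q, r]"
  show "f q p * f r q * f p r + f r p * f q r * f p q = g q p * g r q * g p r + g r p * g q r * g p q"
    using cyc3[OF *] by (simp add: mult.commute mult.left_commute add.commute)
next
  fix b p q r assume *: "b \<in> U" "p \<in> U" "q \<in> U" "r \<in> U" "distinct [b, p, q, r]"
  show "f p b * f q p * f r q * f b r + f p b * f r p * f q r * f b q + f q b * f p q * f r p * f b r
      + f q b * f r q * f p r * f b p + f r b * f p r * f q p * f b q + f r b * f q r * f p q * f b p =
      g p b * g q p * g r q * g b r + g p b * g r p * g q r * g b q + g q b * g p q * g r p * g b r
      + g q b * g r q * g p r * g b p + g r b * g p r * g q p * g b q + g r b * g q r * g p q * g b p"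
    using cyc4[OF *] by (simp add: algebra_simps)
next
  fix b i u v y assume *: "b \<in> U" "i \<in> U" "u \<in> U" "v \<in> U" "y \<in> U" "distinct [b, i, u, v, y]"
  show "f y u * f b v = f y v * f b u \<or> f i y * f b u = f i u * f b y" if "f i u * f b v = f i v * f b u"
    by (rule inc[OF * that])
  show "f u y * f v b = f v y * f u b \<or> f y i * f u b = f u i * f y b" if "f u i * f v b = f v i * f u b"
    by (rule outc[OF * that])
next
  fix p q assume *: "p \<in> U" "q \<in> U" "p \<noteq> q"
  show "f q p \<noteq> 0 \<and> g q p \<noteq> 0" using nz[of q p] * by simp
  show "f q p * f p q = g q p * g p q" using cyc2[of q p] * by simp
qed (rule diag)

lemma minors_swap: "minors U f (\<lambda>p q. g q p)"
proof
  show "f p q * f q p = g q p * g p q" if "p \<in> U" "q \<in> U" "p \<noteq> q" for p q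
    using cyc2[OF that] by (simp add: mult.commute)
next
  fix p q r assume *: "p \<in> U" "q \<in> U" "r \<in> U" "distinct [p, q, r]"
  show "f p q * f q r * f r p + f p r * f r q * f q p = g q p * g r q * g p r + g r p * g q r * g p q"
    using cyc3[OF *] by (simp add: algebra_simps)
next
  fix b p q r assume *: "b \<in> U" "p \<in> U" "q \<in> U" "r \<in> U" "distinct [b, p, q, r]"
  show "f b p * f p q * f q r * f r b + f b p * f p r * f r q * f q b + f b q * f q p * f p r * f r b
      + f b q * f q r * f r p * f p b + f b r * f r p * f p q * f q b + f b r * f r q * f q p * f p b =
      g p b * g q p * g r q * g b r + g p b * g r p * g q r * g b q + g q b * g p q * g r p * g b r
      + g q b * g r q * g p r * g b p + g r b * g p r * g q p * g b q + g r b * g q r * g p q * g b p"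
    using cyc4[OF *] by (simp add: algebra_simps)
next
  fix b i u v y assume *: "b \<in> U" "i \<in> U" "u \<in> U" "v \<in> U" "y \<in> U" "distinct [b, i, u, v, y]"
  show "f y u * f b v = f y v * f b u \<or> f i y * f b u = f i u * f b y" if "f i u * f b v = f i v * f b u"
    by (rule inc[OF * that])
  show "f u y * f v b = f v y * f u b \<or> f y i * f u b = f u i * f y b" if "f u i * f v b = f v i * f u b"
    by (rule outc[OF * that])
next
  fix p q assume *: "p \<in> U" "q \<in> U" "p \<noteq> q"
  show "f p q \<noteq> 0 \<and> g q p \<noteq> 0" using nz[of p q] nz[of q p] * by simp
qed (rule diag)

lemma minors_subset:
  assumes "T \<subseteq> U"
  shows "minors T f g"
proof
  show "f p q \<noteq> 0 \<and> g p q \<noteq> 0" if "p \<in> T" "q \<in> T" "p \<noteq> q" for p q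
    using nz that assms by blast
  show "f p p = g p p" if "p \<in> T" for p using diag that assms by blast
  show "f p q * f q p = g p q * g q p" if "p \<in> T" "q \<in> T" "p \<noteq> q" for p q
    using cyc2 that assms by blast
qed (rule cyc3 cyc4 outc inc; use assms in blast)+

end

text \<open>Up to the constant \<open>f b x * f x b\<close>, which \<open>cyc2\<close> makes common
  to both matrices, normalising at \<open>x\<close> amounts to normalising the matrix already
  normalised at \<open>b\<close>.\<close>

lemma nrm_change_base:
  assumes "f p b \<noteq> 0" "f b q \<noteq> 0" "f b x \<noteq> 0" "f x b \<noteq> 0"
    and "p \<noteq> b" "q \<noteq> b" "p \<noteq> x" "q \<noteq> x" "x \<noteq> b"
  shows "nrm x f p q = nrm b f p q / (nrm b f p x * nrm b f x q * (f b x * f x b))"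
  using assms by (simp add: nrm_def)

section \<open>Derivations under a change of base\<close>

lemma derives_cong:
  assumes "derives V F Y xs" "set xs \<subseteq> V'"
    and "\<And>z W. z \<in> set xs \<Longrightarrow> W \<subseteq> Y \<union> set xs \<Longrightarrow> z \<notin> W \<Longrightarrow> separates F z W \<Longrightarrow> separates F' z W"
  shows "derives V' F' Y xs"
  using assms
proof (induction xs arbitrary: Y)
  case (Cons x xs)
  have "derives V' F' (insert x Y) xs"
    by (rule Cons.IH) (use Cons.prems in auto)
  then show ?case using Cons.prems by auto
qed simp

text \<open>A clan containing \<open>j, k\<close> but neither \<open>b\<close> nor \<open>i\<close> exists unless \<open>i\<close> can be derived from \<open>{j, k}\<close>.\<close>

definition obstruction where
  "obstruction U f g b i j k xs \<longleftrightarrow> minors U f g \<and>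
    b \<in> U \<and> i \<in> U - {b} \<and> j \<in> U - {b} \<and> k \<in> U - {b} \<and> i \<noteq> j \<and> i \<noteq> k \<and> j \<noteq> k \<and>
    kept (nrm b f) (nrm b g) i j \<and> kept (nrm b f) (nrm b g) i k \<and> flipped (nrm b f) (nrm b g) j k \<and>
    derives (U - {b}) (nrm b f) {j, k} (xs @ [i])"

lemma obstruction_transpose:
  assumes "obstruction U f g b i j k xs"
  shows "obstruction U (\<lambda>p q. f q p) (\<lambda>p q. g q p) b i j k xs"
  using assms minors.minors_transpose[of U f g]
  unfolding obstruction_def nrm_transpose[of b f] nrm_transpose[of b g]
    kept_transpose[of "nrm b f" "nrm b g"] flipped_transpose[of "nrm b f" "nrm b g"]
    derives_transpose[of _ "nrm b f"] by blast

lemma obstruction_swap: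
  assumes "minors U f g" "b \<in> U" "i \<in> U - {b}" "j \<in> U - {b}" "k \<in> U - {b}" "i \<noteq> j" "i \<noteq> k" "j \<noteq> k"
    "flipped (nrm b f) (nrm b g) i j" "flipped (nrm b f) (nrm b g) i k" "kept (nrm b f) (nrm b g) j k"
    "derives (U - {b}) (nrm b f) {j, k} (xs @ [i])"
  shows "obstruction U f (\<lambda>p q. g q p) b i j k xs"
  using assms minors.minors_swap[of U f g]
  unfolding obstruction_def nrm_transpose[of b g] kept_swap[of "nrm b f" "nrm b g"]
    flipped_swap[of "nrm b f" "nrm b g"] by blast

text \<open>Shorter derivations, also for other base vertices and after exchanging the colours, are
  excluded by induction. This fixes the colours near the end of the derivation so far that the base
  can be moved to \<open>x\<close>, where a shorter derivation remains.\<close>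

lemma obstruction_step:
  fixes f g :: "'v \<Rightarrow> 'v \<Rightarrow> 'a::field"
  assumes ob: "obstruction U f g b i j k (zs @ [x, y])" and yi: "nrm b f y i \<noteq> nrm b f j i"
    and IH: "\<And>(f :: 'v \<Rightarrow> 'v \<Rightarrow> 'a) g b i j k xs. length xs < length zs + 2 \<Longrightarrow> \<not> obstruction U f g b i j k xs"
  shows False
proof -
  define V F G where "V = U - {b}" and "F = nrm b f" and "G = nrm b g"
  define Y where "Y = {j, k} \<union> set zs"
  interpret minors U f g using ob by (simp add: obstruction_def)
  have b: "b \<in> U" using ob by (simp add: obstruction_def)
  interpret c: coloured V F G unfolding V_def F_def G_def by (rule coloured_nrm[OF b])
  have V: "i \<in> V" "j \<in> V" "k \<in> V" "i \<noteq> j" "i \<noteq> k" "j \<noteq> k"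
    and col: "c.red i j" "c.red i k" "c.blue j k"
    and der: "derives V F {j, k} (zs @ [x, y] @ [i])"
    using ob by (auto simp: obstruction_def V_def F_def G_def)
  have dz: "derives V F {j, k} zs" and x: "x \<in> V" "x \<notin> Y" "separates F x Y"
    and y: "y \<in> V" "y \<notin> insert x Y" "separates F y (insert x Y)"
    and i: "i \<notin> insert y (insert x Y)"
    using der by (auto simp: derives_append Y_def)
  have jY: "j \<in> Y" "k \<in> Y" by (auto simp: Y_def)
  have YV: "Y \<subseteq> V" using derives_set[OF dz] V by (auto simp: Y_def)
  have yi': "F y i \<noteq> F j i" using yi by (simp add: F_def)
  have sep_i: "separates F i Z" if "y \<in> Z" "j \<in> Z" for Z
    using yi' that unfolding separates_def by blast
  have shorter: False if "length ws < length zs + 2" "derives V F {j, k} (ws @ [i])" for ws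
    using IH[OF that(1), of f g b i j k] that(2) ob by (auto simp: obstruction_def V_def F_def)
  have shorter_red: False
    if "length ws < length zs + 2" "derives V F {j, k} (ws @ [z])" "c.red z j" "c.red z k" for ws z
  proof -
    have "z \<in> V" "z \<noteq> j" "z \<noteq> k" using derives_set[OF that(2)] by auto
    then have "obstruction U f g b z j k ws"
      using ob that by (auto simp: obstruction_def V_def F_def G_def)
    then show False using IH that(1) by blast
  qed
  \<comment> \<open>After exchanging the colours, \<open>z\<close> is the apex over
    \<open>{i, j}\<close> or \<open>{i, k}\<close>. The asymmetry of \<open>i j\<close> makes the
    left-out one of \<open>k, j\<close> a splitter of the new pair; it is put in front of
    \<open>ws\<close>, which costs one element and hence the sharper bound.\<close>
  have shorter_blue: False
    if ws: "length ws < length zs + 1" "derives V F {j, k} (ws @ [z])" "i \<notin> set (ws @ [z])"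
      and bl: "c.blue z i" "c.blue z j" "c.blue z k" for ws z
  proof -
    have z: "z \<in> V" "z \<noteq> j" "z \<noteq> k" "z \<noteq> i" "j \<notin> set ws" "k \<notin> set ws"
      using derives_set[OF ws(2)] ws(3) by auto
    have ik: "F i j = F i k" "F j i = F k i" using c.twins_red[of i j k] V col by auto
    have "F i j \<noteq> F j i" using col by (simp add: kept_def)
    then consider "separates F k {i, j}" | "separates F j {i, k}"
      using ik unfolding separates_def by (metis insertCI)
    then show False
    proof cases
      case 1
      have "derives V F {k, i, j} (ws @ [z])"
        by (rule derives_mono[OF ws(2)]) (use z ws V in auto)
      then have "derives V F {i, j} ((k # ws) @ [z])" using 1 V by simp
      then have "obstruction U f (\<lambda>p q. g q p) b z i j (k # ws)"
        using bl col z V b minors_axioms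
        by (intro obstruction_swap) (simp_all add: V_def F_def G_def)
      then show False using IH[of "k # ws"] ws(1) by auto
    next
      case 2
      have "derives V F {j, i, k} (ws @ [z])"
        by (rule derives_mono[OF ws(2)]) (use z ws V in auto)
      then have "derives V F {i, k} ((j # ws) @ [z])" using 2 V by simp
      then have "obstruction U f (\<lambda>p q. g q p) b z i k (j # ws)"
        using bl col z V b minors_axioms
        by (intro obstruction_swap) (simp_all add: V_def F_def G_def)
      then show False using IH[of "j # ws"] ws(1) by auto
    qed
  qed
  have N1: "\<not> separates F i (insert x Y)"
  proof
    assume "separates F i (insert x Y)"
    then have "derives V F {j, k} ((zs @ [x]) @ [i])"
      using dz x i V by (auto simp: derives_append Y_def)
    then show False using shorter[of "zs @ [x]"] by simp
  qed
  have N2: "\<not> separates F y Y"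
  proof
    assume "separates F y Y"
    then have "derives V F {j, k} ((zs @ [y]) @ [i])"
      using dz y i V sep_i[of "insert y Y"] by (auto simp: derives_append Y_def)
    then show False using shorter[of "zs @ [y]"] by simp
  qed
  show False
  proof (cases zs rule: rev_cases)
    case Nil
    then have Y: "Y = {j, k}" by (simp add: Y_def)
    show False
      by (rule c.no_derivation_3[of i j k x y]) (use V x y i col N1 N2 yi' in \<open>auto simp: Y\<close>)
  next
    case (snoc ws u)
    define Y0 where "Y0 = {j, k} \<union> set ws"
    have Y: "Y = insert u Y0" by (auto simp: Y_def Y0_def snoc)
    have dw: "derives V F {j, k} ws" and u: "u \<in> V" "u \<notin> Y0" "separates F u Y0"
      using dz by (auto simp: snoc derives_append Y0_def)
    have jY0: "j \<in> Y0" "k \<in> Y0" by (auto simp: Y0_def)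
    have dwu: "derives V F {j, k} (ws @ [u])" using dz by (simp add: snoc)
    have dzx: "derives V F {j, k} (zs @ [x])" using dz x by (auto simp: derives_append Y_def)
    have yx: "F x y \<noteq> F j y \<or> F y x \<noteq> F y j"
      using y(3) separates_insert[OF N2 jY(1)] by simp
    have N3: "\<not> separates F x Y0"
    proof
      assume "separates F x Y0"
      moreover have "separates F y (insert x Y0)"
        using yx jY0 unfolding separates_def by blast
      ultimately have "derives V F {j, k} ((ws @ [x, y]) @ [i])"
        using dw x y i V sep_i[of "insert y (insert x Y0)"]
        by (auto simp: derives_append Y0_def Y)
      then show False using shorter[of "ws @ [x, y]"] by (simp add: snoc)
    qed
    have ih: "\<not> (c.red x j \<and> c.red x k)" "\<not> (c.red u j \<and> c.red u k)"
      using shorter_red[of zs x] shorter_red[of ws u] dzx dwu by (auto simp: snoc)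
    have ih': "\<not> (c.blue x i \<and> c.blue x j \<and> c.blue x k)"
      "\<not> (c.blue u i \<and> c.blue u j \<and> c.blue u k)"
      using shorter_blue[of zs x] shorter_blue[of ws u] dzx dwu i by (auto simp: snoc Y_def)
    have Y0: "Y0 \<subseteq> V" "i \<notin> Y0" "x \<notin> Y0" "y \<notin> Y0" "distinct [i, u, x, y]"
      using YV i x(2) y(2) by (auto simp: Y)
    note r = c.derivation_tail[OF Y0(1) jY0 V(6) V(1) u(1) x(1) y(1) Y0(2) u(2) Y0(3-5) col
        N1[unfolded Y] N2[unfolded Y] y(3)[unfolded Y] N3 x(3)[unfolded Y] yi' ih ih']
    \<comment> \<open>From here \<open>x\<close> serves as the base: \<open>u\<close> becomes the
      apex over \<open>j, k\<close>, and \<open>ws\<close>, shorter than \<open>zs\<close> by one,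
      derives it.\<close>
    have xV: "x \<in> U" "x \<noteq> b" using x by (auto simp: V_def)
    have nx: "f b x \<noteq> 0" "f x b \<noteq> 0" "g b x \<noteq> 0" "g x b \<noteq> 0"
      using nz[of b x] nz[of x b] b xV by auto
    have fg: "g b x * g x b = f b x * f x b" using cyc2[of b x] b xV by auto
    define \<kappa> where "\<kappa> = f b x * f x b"
    have \<kappa>: "\<kappa> \<noteq> 0" using nx by (simp add: \<kappa>_def)
    have Fx: "nrm x f p q = F p q / (F p x * F x q * \<kappa>)"
      and Gx: "nrm x g p q = G p q / (G p x * G x q * \<kappa>)"
      if "p \<in> V - {x}" "q \<in> V - {x}" for p q
      using nrm_change_base[of f p b q x] nrm_change_base[of g p b q x] nx nz[of p b] nz[of b q] that b xV
      by (auto simp: F_def G_def V_def \<kappa>_def fg)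
    define \<gamma> where "\<gamma> = F x j"
    have xj: "x \<noteq> j" "x \<noteq> k" "x \<noteq> u" using x Y jY0 by auto
    have \<gamma>: "\<gamma> \<noteq> 0" using c.nonzero[of x j] x V xj by (auto simp: \<gamma>_def)
    have Fx0: "F x z \<noteq> 0" "F z x \<noteq> 0" if "z \<in> V - {x}" for z
      using c.nonzero[of x z] c.nonzero[of z x] x that by auto
    have Y0V: "Y0 \<subseteq> V - {x}" using YV x Y by auto
    have \<gamma>w: "F x w = \<gamma>" "F w x = \<gamma>" if "w \<in> Y0" for w
      using r(1)[OF that] by (auto simp: \<gamma>_def)
    \<comment> \<open>All weights between \<open>x\<close> and \<open>Y0\<close> equal
      \<open>\<gamma>\<close>, so the new normalisation rescales the entries from \<open>Y0\<close>
      to \<open>z\<close> by one common factor, and likewise those from \<open>z\<close> to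
      \<open>Y0\<close>. Splitting survives.\<close>
    have sep: "separates (nrm x f) z W" if zW: "z \<in> V - {x}" "W \<subseteq> Y0" "separates F z W" for z W
    proof -
      obtain v w where vw: "v \<in> W" "w \<in> W" "F v z \<noteq> F w z \<or> F z v \<noteq> F z w"
        using zW(3) unfolding separates_def by blast
      have m: "v \<in> Y0" "w \<in> Y0" "v \<in> V - {x}" "w \<in> V - {x}" using vw zW Y0V by auto
      have "nrm x f v z \<noteq> nrm x f w z \<or> nrm x f z v \<noteq> nrm x f z w"
        using vw(3) Fx0[OF zW(1)] \<gamma> \<kappa> m zW(1) by (simp add: Fx \<gamma>w)
      then show ?thesis using vw unfolding separates_def by blast
    qed
    have uV: "u \<in> V - {x}" using u xj by auto
    have zV: "set zs \<subseteq> V - {x}" using YV x by (auto simp: Y_def)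
    have d1: "derives (U - {x}) (nrm x f) {j, k} ws"
      by (rule derives_cong[OF dw]) (use zV sep in \<open>auto simp: snoc V_def Y0_def\<close>)
    have "derives (U - {x}) (nrm x f) {j, k} (ws @ [u])"
      using d1 u uV sep[OF uV, of Y0] by (auto simp: derives_append Y0_def V_def)
    moreover have G_eq: "G p q = F p q" "G q p = F q p"
      if "p \<in> V" "q \<in> V" "p \<noteq> q" "c.neut p q" for p q
      using c.pair[OF that(1-3)] that(4) by (auto simp: neutral_def)
    have ux: "F u x \<noteq> \<gamma>" "G u x = F u x" "G x u = \<gamma>"
      using r(2,3) by (auto simp: kept_def \<gamma>_def)
    have jV: "j \<in> V - {x}" "k \<in> V - {x}" using V xj by auto
    have neutx: "c.neut x l" if "l = j \<or> l = k" for l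
      using that \<gamma>w[of l] jY0 by (auto simp: neutral_def)
    \<comment> \<open>The neutral edge \<open>u l\<close> is rescaled by \<open>F u x\<close> in one
      direction and by \<open>F x u\<close> in the other. These differ because \<open>x u\<close> is
      red, and they are the same for \<open>G\<close>, so the edge becomes red.\<close>
    have kept_x: "kept (nrm x f) (nrm x g) u l" if l: "l = j \<or> l = k" for l
    proof -
      have lu: "l \<in> V - {x}" "u \<noteq> l" "l \<in> Y0" using l jV u jY0 by auto
      have n: "c.neut u l" using l r(4,5) by auto
      have Gl: "G u l = F u l" "G l u = F l u" "G x l = \<gamma>" "G l x = \<gamma>" "F l u = F u l"
        using G_eq[of u l] G_eq[of x l] n neutx[OF l] lu uV x(1) \<gamma>w[OF lu(3)]
        by (auto simp: neutral_def)
      have "F u l \<noteq> 0" using c.nonzero[of u l] uV lu by auto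
      then show ?thesis
        using Fx0[OF uV] \<gamma> \<kappa> ux r(2) uV lu Gl
        by (simp add: kept_def Fx Gx \<gamma>w \<gamma>_def[symmetric])
    qed
    moreover have "flipped (nrm x f) (nrm x g) j k"
    proof -
      have "G x l = \<gamma>" "G l x = \<gamma>" if "l = j \<or> l = k" for l
        using G_eq[of x l] neutx[OF that] that jV x(1) \<gamma>w[of l] jY0 by auto
      then show ?thesis
        using col(3) \<gamma> \<kappa> jV jY0 by (simp add: flipped_def Fx Gx \<gamma>w)
    qed
    ultimately have "obstruction U f g x u j k ws"
      using uV jV V xV minors_axioms u jY0 by (auto simp: obstruction_def V_def)
    then show False using IH[of ws] by (simp add: snoc)
  qed
qed

lemma no_obstruction:
  fixes f g :: "'v \<Rightarrow> 'v \<Rightarrow> 'a::field"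
  shows "\<not> obstruction U f g b i j k xs"
proof (induction "length xs" arbitrary: f g b i j k xs rule: less_induct)
  case less
  show ?case
  proof
    assume ob: "obstruction U f g b i j k xs"
    define V F G where "V = U - {b}" and "F = nrm b f" and "G = nrm b g"
    interpret minors U f g using ob by (simp add: obstruction_def)
    have b: "b \<in> U" using ob by (simp add: obstruction_def)
    interpret c: coloured V F G unfolding V_def F_def G_def by (rule coloured_nrm[OF b])
    have V: "i \<in> V" "j \<in> V" "k \<in> V" "i \<noteq> j" "i \<noteq> k" "j \<noteq> k"
      and col: "c.red i j" "c.red i k" "c.blue j k"
      and der: "derives V F {j, k} (xs @ [i])"
      using ob by (auto simp: obstruction_def V_def F_def G_def)
    have ik: "F i j = F i k" "F j i = F k i" using c.twins_red[of i j k] V col by auto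
    have i0: "\<not> separates F i {j, k}" using ik by (auto simp: separates_def)
    consider "xs = []" | y where "xs = [y]" | zs x y where "xs = zs @ [x, y]"
      by (metis append_Cons append_Nil append_assoc rev_exhaust)
    then show False
    proof cases
      case 1
      then show False using der i0 by simp
    next
      case (2 y)
      then have y: "y \<in> V" "y \<noteq> j" "y \<noteq> k" "y \<noteq> i" "separates F y {j, k}"
        and i: "separates F i {y, j, k}" using der by auto
      have "F j y \<noteq> F k y \<or> F y j \<noteq> F y k" using y(5) unfolding separates_def by auto
      then have "F i y = F i j \<and> F y i = F j i"
        using c.splitter_twin_red[of i j k y] V y col by auto
      then show False using i separates_insert[OF i0, of j y] by auto
    next
      case (3 zs x y)
      have IH: "\<not> obstruction U f g b i j k xs'" if "length xs' < length zs + 2" for f g :: "'v \<Rightarrow> 'v \<Rightarrow> 'a" and b i j k xs'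
        using less that by (simp add: 3)
      define Y where "Y = insert x ({j, k} \<union> set zs)"
      have "derives V F {j, k} (zs @ [x])" "i \<notin> Y" "separates F i (insert y Y)"
        using der by (auto simp: 3 derives_append Y_def insert_commute)
      moreover have "\<not> separates F i Y"
      proof
        assume "separates F i Y"
        then have "derives V F {j, k} ((zs @ [x]) @ [i])"
          using calculation V by (auto simp: derives_append Y_def)
        then have "obstruction U f g b i j k (zs @ [x])"
          using ob by (simp add: obstruction_def V_def F_def)
        then show False using IH[of "zs @ [x]"] by simp
      qed
      moreover have "j \<in> Y" by (simp add: Y_def)
      \<comment> \<open>\<open>obstruction_step\<close> treats a difference in the entries towards
        \<open>i\<close>; a difference in the opposite direction is the same situation for the
        transposed matrices.\<close>
      ultimately have "F y i \<noteq> F j i \<or> F i y \<noteq> F i j"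
        using separates_insert by metis
      then show False
        using obstruction_step[of U f g b i j k zs x y] IH ob obstruction_transpose[OF ob]
          obstruction_step[of U "\<lambda>p q. f q p" "\<lambda>p q. g q p" b i j k zs x y]
        by (auto simp: 3 F_def nrm_transpose[of b f])
    qed
  qed
qed

section \<open>Clans\<close>

text \<open>Both off-diagonal blocks between \<open>X\<close> and \<open>S - X\<close> have rank at most one.\<close>

definition clan where
  "clan S f X \<longleftrightarrow> X \<subseteq> S \<and> (\<forall>u\<in>X. \<forall>v\<in>X. \<forall>y\<in>S - X. \<forall>z\<in>S - X.
    f u y * f v z = f u z * f v y \<and> f y u * f z v = f z u * f y v)"

lemma clan_complement:
  fixes f :: "'v \<Rightarrow> 'v \<Rightarrow> 'a::field"
  assumes "clan S f X"
  shows "clan S f (S - X)"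
proof -
  have "S - (S - X) = X" using assms by (auto simp: clan_def)
  moreover have "f y u * f z v = f y v * f z u" "f u y * f v z = f v y * f u z"
    if "u \<in> X" "v \<in> X" "y \<in> S - X" "z \<in> S - X" for u v y z
    using assms that unfolding clan_def by (metis mult.commute)+
  ultimately show ?thesis unfolding clan_def by auto
qed

context minors
begin

text \<open>With ones in the row and column of \<open>b\<close>, the 2 by 2 minors that use
  \<open>b\<close> turn proportional rows and columns into equal ones: clans avoiding
  \<open>b\<close> are the modules of the normalised matrix.\<close>

lemma clan_nrm:
  assumes b: "b \<in> U" and X: "X \<subseteq> U - {b}"
  shows "clan U f X \<longleftrightarrow> (\<forall>u\<in>X. \<forall>v\<in>X. \<forall>y\<in>U - {b} - X.
    nrm b f u y = nrm b f v y \<and> nrm b f y u = nrm b f y v)"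
proof -
  have n: "f p b \<noteq> 0" "f b p \<noteq> 0" if "p \<in> U - {b}" for p
    using nz[of p b] nz[of b p] b that by auto
  have F: "f p q = nrm b f p q * f p b * f b q" if "p \<in> U - {b}" "q \<in> U - {b}" for p q
    using n that by (simp add: nrm_def)
  show ?thesis
  proof (intro iffI ballI)
    fix u v y assume cl: "clan U f X" and u: "u \<in> X" "v \<in> X" and y: "y \<in> U - {b} - X"
    then have "f u y * f v b = f u b * f v y" "f y u * f b v = f b u * f y v"
      using b X unfolding clan_def by blast+
    moreover have "u \<in> U - {b}" "v \<in> U - {b}" "y \<in> U - {b}" using u y X by auto
    ultimately show "nrm b f u y = nrm b f v y \<and> nrm b f y u = nrm b f y v"
      using n by (simp add: nrm_def field_simps)
  next
    assume *: "\<forall>u\<in>X. \<forall>v\<in>X. \<forall>y\<in>U - {b} - X. nrm b f u y = nrm b f v y \<and> nrm b f y u = nrm b f y v"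
    have "f u y * f v z = f u z * f v y \<and> f y u * f z v = f z u * f y v"
      if u: "u \<in> X" "v \<in> X" and y: "y \<in> U - X" "z \<in> U - X" for u v y z
    proof -
      have uV: "u \<in> U - {b}" "v \<in> U - {b}" using u X by auto
      have out: "f u w = nrm b f v w * f u b * f b w" "f w u = nrm b f w v * f w b * f b u"
        "f v w = nrm b f v w * f v b * f b w" "f w v = nrm b f w v * f w b * f b v"
        if "w \<in> U - {b} - X" for w
      proof -
        have w: "w \<in> U - {b}" using that by auto
        have e: "nrm b f u w = nrm b f v w" "nrm b f w u = nrm b f w v" using * u that by blast+
        show "f u w = nrm b f v w * f u b * f b w" "f w u = nrm b f w v * f w b * f b u"
          "f v w = nrm b f v w * f v b * f b w" "f w v = nrm b f w v * f w b * f b v"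
          using F[OF uV(1) w] F[OF w uV(1)] F[OF uV(2) w] F[OF w uV(2)] unfolding e by blast+
      qed
      show ?thesis
      proof (cases "y = b"; cases "z = b")
        assume "y \<noteq> b" "z \<noteq> b"
        then have w: "y \<in> U - {b} - X" "z \<in> U - {b} - X" using y by auto
        show ?thesis unfolding out[OF w(1)] out[OF w(2)] by (simp add: algebra_simps)
      next
        assume "y = b" "z \<noteq> b"
        then have w: "z \<in> U - {b} - X" using y by auto
        show ?thesis unfolding \<open>y = b\<close> out[OF w(1)] by (simp add: algebra_simps)
      next
        assume "y \<noteq> b" "z = b"
        then have w: "y \<in> U - {b} - X" using y by auto
        show ?thesis unfolding \<open>z = b\<close> out[OF w(1)] by (simp add: algebra_simps)
      qed simp
    qed
    then show "clan U f X" using X unfolding clan_def by blast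
  qed
qed

section \<open>Clans forced by mixed colours\<close>

lemma nrm_base:
  assumes b: "b \<in> U" "x \<in> U" "x \<noteq> b" and p: "p \<in> U - {b, x}" "q \<in> U - {b, x}"
  shows "nrm x f p q = nrm b f p q / (nrm b f p x * nrm b f x q * (f b x * f x b))"
    and "nrm x g p q = nrm b g p q / (nrm b g p x * nrm b g x q * (f b x * f x b))"
proof -
  have "g b x * g x b = f b x * f x b" using cyc2[of b x] b by auto
  then show "nrm x f p q = nrm b f p q / (nrm b f p x * nrm b f x q * (f b x * f x b))"
    and "nrm x g p q = nrm b g p q / (nrm b g p x * nrm b g x q * (f b x * f x b))"
    using nrm_change_base[of f p b q x] nrm_change_base[of g p b q x] p b
      nz[of p b] nz[of b q] nz[of b x] nz[of x b] by auto
qed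

text \<open>A longest sequence of splitters closes \<open>{j, k}\<close> to a clan. It misses
  \<open>i\<close> by \<open>no_obstruction\<close> and \<open>b\<close> by construction, whence the
  two bounds.\<close>

lemma clan_of_red_red_blue:
  assumes fin: "finite U" and b: "b \<in> U"
    and V: "i \<in> U - {b}" "j \<in> U - {b}" "k \<in> U - {b}" "i \<noteq> j" "i \<noteq> k" "j \<noteq> k"
    and col: "kept (nrm b f) (nrm b g) i j" "kept (nrm b f) (nrm b g) i k" "flipped (nrm b f) (nrm b g) j k"
  shows "\<exists>X. clan U f X \<and> 2 \<le> card X \<and> 2 \<le> card (U - X)"
proof -
  let ?D = "derives (U - {b}) (nrm b f) {j, k}"
  have "length xs < Suc (card (U - {b}))" if "?D xs" for xs
    using derives_set[OF that] fin
    by (metis card_mono distinct_card finite_Diff less_Suc_eq_le)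
  then obtain xs where xs: "?D xs" and max: "\<And>ys. ?D ys \<Longrightarrow> length ys \<le> length xs"
    using ex_has_greatest_nat[of ?D "[]" length "Suc (card (U - {b}))"] by auto
  define X where "X = {j, k} \<union> set xs"
  have "i \<notin> X"
  proof
    assume "i \<in> X"
    then obtain as bs where "xs = as @ i # bs" using V by (auto simp: X_def dest: split_list)
    then have "?D (as @ [i])" using xs by (simp add: derives_append)
    then have "obstruction U f g b i j k as"
      using V col b minors_axioms by (simp add: obstruction_def)
    then show False by (rule notE[OF no_obstruction])
  qed
  have XV: "X \<subseteq> U - {b}" using derives_set[OF xs] V by (auto simp: X_def)
  have "\<not> separates (nrm b f) y X" if "y \<in> U - {b} - X" for y
  proof
    assume "separates (nrm b f) y X"
    then have "?D (xs @ [y])" using xs that by (simp add: derives_append X_def)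
    then show False using max by fastforce
  qed
  then have "clan U f X"
    unfolding clan_nrm[OF b XV] separates_def by blast
  moreover have "card {j, k} \<le> card X"
    using fin XV by (intro card_mono) (auto simp: X_def intro: finite_subset)
  moreover have "card {b, i} \<le> card (U - X)"
    using fin XV V b \<open>i \<notin> X\<close> by (intro card_mono) auto
  ultimately show ?thesis using V by auto
qed

lemma clan_of_blue_blue_red:
  assumes "finite U" "b \<in> U"
    "i \<in> U - {b}" "j \<in> U - {b}" "k \<in> U - {b}" "i \<noteq> j" "i \<noteq> k" "j \<noteq> k"
    "flipped (nrm b f) (nrm b g) i j" "flipped (nrm b f) (nrm b g) i k" "kept (nrm b f) (nrm b g) j k"
  shows "\<exists>X. clan U f X \<and> 2 \<le> card X \<and> 2 \<le> card (U - X)"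
proof -
  interpret sw: minors U f "\<lambda>p q. g q p" by (rule minors_swap)
  show ?thesis
    using sw.clan_of_red_red_blue[OF assms(1-8)] assms(9-)
    unfolding nrm_transpose[of b g] kept_swap[of "nrm b f" "nrm b g"] flipped_swap[of "nrm b f" "nrm b g"]
    by blast
qed

text \<open>If a red and a blue edge meet, the third edge is coloured, and one of the two preceding
  lemmas applies. A coloured edge between \<open>p, q\<close> and \<open>r, s\<close> reduces to
  this case; if all four are neutral, the base is moved to \<open>p\<close>.\<close>

lemma clan_of_red_blue:
  assumes fin: "finite U" and b: "b \<in> U"
    and V: "p \<in> U - {b}" "q \<in> U - {b}" "r \<in> U - {b}" "s \<in> U - {b}" "p \<noteq> q" "r \<noteq> s"
    and col: "kept (nrm b f) (nrm b g) p q" "flipped (nrm b f) (nrm b g) r s"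
  shows "\<exists>X. clan U f X \<and> 2 \<le> card X \<and> 2 \<le> card (U - X)"
proof -
  define V F G where "V = U - {b}" and "F = nrm b f" and "G = nrm b g"
  interpret c: coloured V F G unfolding V_def F_def G_def by (rule coloured_nrm[OF b])
  note V = V[folded V_def] and col = col[folded F_def G_def]
  have adj: ?thesis if W: "x \<in> V" "y \<in> V" "z \<in> V" "x \<noteq> y" "x \<noteq> z" "y \<noteq> z" "c.red x y" "c.blue x z" for x y z
  proof -
    have "\<not> c.neut y z" using c.no_rainbow[of y x z] W c.red_commute by metis
    then consider "c.red y z" | "c.blue y z" using c.colours[of y z] W by metis
    then show ?thesis
    proof cases
      case 1
      show ?thesis
        by (rule clan_of_red_red_blue[OF fin b, of y x z])
          (use W 1 c.red_commute[of x y] in \<open>auto simp: V_def F_def G_def\<close>)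
    next
      case 2
      show ?thesis
        by (rule clan_of_blue_blue_red[OF fin b, of z x y])
          (use W 2 c.blue_commute in \<open>auto simp: V_def F_def G_def\<close>)
    qed
  qed
  have not_both: "\<not> (c.red x y \<and> c.blue x y)" for x y by (auto simp: kept_def flipped_def)
  have adj': ?thesis if "x \<in> V" "y \<in> V" "z \<in> V" "x \<noteq> y" "x \<noteq> z" "c.red x y" "c.blue x z" for x y z
    using adj[of x y z] that not_both by metis
  show ?thesis
  proof (cases "p = r \<or> p = s \<or> q = r \<or> q = s")
    case True
    then show ?thesis
      using adj'[of p q s] adj'[of p q r] adj'[of q p s] adj'[of q p r] V col c.red_commute c.blue_commute
      by metis
  next
    case False
    have cross: "c.neut x y \<or> ?thesis" if x: "x = p \<or> x = q" and y: "y = r \<or> y = s" for x y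
    proof -
      obtain x' where x': "x' \<in> V" "x' \<noteq> x" "c.red x x'"
        using x V col c.red_commute by metis
      obtain y' where y': "y' \<in> V" "y' \<noteq> y" "c.blue y y'"
        using y V col c.blue_commute by metis
      have xy: "x \<in> V" "y \<in> V" "x \<noteq> y" using x y V False by auto
      show ?thesis
        using adj'[of x x' y] adj'[of y x y'] x' y' xy c.colours[of x y] c.red_commute[of x y] by metis
    qed
    show ?thesis
    proof (rule ccontr)
      assume no: "\<not> ?thesis"
      have n: "c.neut p r" "c.neut p s" "c.neut q r" "c.neut q s" using cross no by blast+
      have G_eq: "G x y = F x y" "G y x = F y x" if "x \<in> V" "y \<in> V" "x \<noteq> y" "c.neut x y" for x y
        using c.pair[OF that(1-3)] that(4) by (auto simp: neutral_def)
      have pV: "p \<in> U" "p \<noteq> b" using V by (auto simp: V_def)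
      have qrs: "q \<in> U - {b, p}" "r \<in> U - {b, p}" "s \<in> U - {b, p}"
        using V False by (auto simp: V_def)
      have N: "F x y \<noteq> 0" if "x \<in> V" "y \<in> V" "x \<noteq> y" for x y using c.nonzero that by blast
      have \<kappa>: "f b p * f p b \<noteq> 0" using nz[of b p] nz[of p b] b pV by auto
      have Fp: "nrm p f x y = F x y / (F x p * F p y * (f b p * f p b))"
        and Gp: "nrm p g x y = G x y / (G x p * G p y * (f b p * f p b))"
        if "x \<in> {q, r, s}" "y \<in> {q, r, s}" for x y
        using nrm_base[OF b pV, of x y] that qrs by (auto simp: F_def G_def)
      \<comment> \<open>With base \<open>p\<close> the neutral edges from \<open>q\<close> to
        \<open>r\<close> and \<open>s\<close> become red, since the factors \<open>F q p\<close> and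
        \<open>F p q\<close> differ. The edge \<open>r s\<close> is scaled symmetrically and stays
        blue, so \<open>q\<close> is the apex of a bad triangle.\<close>
      have kept_p: "kept (nrm p f) (nrm p g) q y" if y: "y = r \<or> y = s" for y
      proof -
        have yy: "y \<in> {q, r, s}" "y \<in> V" "p \<noteq> y" "q \<noteq> y" "c.neut p y" "c.neut q y"
          using y V n False by auto
        have "F y p = F p y" "F y q = F q y" using yy by (auto simp: neutral_def)
        moreover have "G y p = F p y" "G p y = F p y" "G y q = F q y" "G q y = F q y"
          using G_eq[of p y] G_eq[of q y] yy V calculation by auto
        moreover have "F p y \<noteq> 0" "F q y \<noteq> 0" "F p q \<noteq> 0" "F q p \<noteq> 0" using N V yy by auto
        ultimately show ?thesis
          using \<kappa> col(1) yy(1) unfolding kept_def by (auto simp: Fp Gp)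
      qed
      have "flipped (nrm p f) (nrm p g) r s"
      proof -
        have "F r p = F p r" "F s p = F p s" using n by (auto simp: neutral_def)
        moreover have "G r p = F p r" "G p r = F p r" "G s p = F p s" "G p s = F p s"
          using G_eq[of p r] G_eq[of p s] V n False calculation by auto
        moreover have "F p r \<noteq> 0" "F p s \<noteq> 0" using N V False by auto
        ultimately show ?thesis
          using \<kappa> col(2) unfolding flipped_def
          by (auto simp: Fp Gp mult.commute[of "F p s" "F p r"])
      qed
      then have ?thesis
        using clan_of_red_red_blue[OF fin pV(1), of q r s] kept_p V False pV by (auto simp: V_def)
      then show False using no by blast
    qed
  qed
qed

section \<open>Equality of all minors\<close>

lemma nrm_diag:
  assumes "b \<in> U" "p \<in> U"
  shows "nrm b f p p = nrm b g p p"
  using assms diag cyc2[of p b] by (auto simp: nrm_def)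

text \<open>By \<open>cyc2\<close> the scaling factor, a product over \<open>T - {b}\<close>, is the
  same nonzero number for both matrices, whether or not \<open>b\<close> lies in
  \<open>T\<close>.\<close>

lemma pdet_nrm_eq_iff:
  assumes b: "b \<in> U" and T: "T \<subseteq> U" "finite T"
  shows "pdet f T = pdet g T \<longleftrightarrow> pdet (nrm b f) T = pdet (nrm b g) T"
proof -
  have scale: "pdet h T = (\<Prod>p\<in>T - {b}. h p b * h b p) * pdet (nrm b h) T"
    if h: "\<And>p. p \<in> U - {b} \<Longrightarrow> h p b \<noteq> 0 \<and> h b p \<noteq> 0" for h :: "'v \<Rightarrow> 'v \<Rightarrow> 'a"
  proof -
    let ?c = "\<lambda>p. if p = b then 1 else h p b" and ?d = "\<lambda>p. if p = b then 1 else h b p"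
    have "pdet h T = pdet (\<lambda>p q. ?c p * ?d q * nrm b h p q) T"
    proof (rule pdet_cong)
      fix p q assume "p \<in> T" "q \<in> T"
      then show "h p q = ?c p * ?d q * nrm b h p q"
        using h[of p] h[of q] T by (auto simp: nrm_def)
    qed
    also have "\<dots> = (\<Prod>p\<in>T. ?c p * ?d p) * pdet (nrm b h) T" by (rule pdet_scale[OF T(2)])
    also have "(\<Prod>p\<in>T. ?c p * ?d p) = (\<Prod>p\<in>T - {b}. h p b * h b p)"
      by (rule prod.mono_neutral_cong_right[OF T(2)]) auto
    finally show ?thesis .
  qed
  have n: "f p b \<noteq> 0 \<and> f b p \<noteq> 0" "g p b \<noteq> 0 \<and> g b p \<noteq> 0" if "p \<in> U - {b}" for p
    using nz[of p b] nz[of b p] b that by auto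
  have "(\<Prod>p\<in>T - {b}. g p b * g b p) = (\<Prod>p\<in>T - {b}. f p b * f b p)"
    using cyc2 b T by (intro prod.cong) auto
  moreover have "(\<Prod>p\<in>T - {b}. f p b * f b p) \<noteq> 0"
    using n T by (auto simp: prod_zero_iff finite_Diff)
  ultimately show ?thesis using scale[of f] scale[of g] n by simp
qed

lemma pdet_eq_if_unicoloured:
  assumes b: "b \<in> U" and fin: "finite U"
    and col: "(\<forall>p\<in>U - {b}. \<forall>q\<in>U - {b}. \<not> flipped (nrm b f) (nrm b g) p q) \<or>
      (\<forall>p\<in>U - {b}. \<forall>q\<in>U - {b}. \<not> kept (nrm b f) (nrm b g) p q)"
  shows "pdet f U = pdet g U"
proof -
  define V F G where "V = U - {b}" and "F = nrm b f" and "G = nrm b g"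
  interpret c: coloured V F G unfolding V_def F_def G_def by (rule coloured_nrm[OF b])
  have border: "F b p = G b p" "F p b = G p b" "F b p = F p b" if "p \<in> U" for p
    using diag[OF b] that by (auto simp: F_def G_def nrm_def)
  have dg: "F p p = G p p" if "p \<in> U" for p
    using nrm_diag[OF b that] by (simp add: F_def G_def)
  have "pdet F U = pdet G U"
    using col
  proof
    assume nb: "\<forall>p\<in>U - {b}. \<forall>q\<in>U - {b}. \<not> flipped (nrm b f) (nrm b g) p q"
    show ?thesis
    proof (rule pdet_cong)
      fix p q assume pq: "p \<in> U" "q \<in> U"
      consider "p = b" | "q = b" | "p = q" | "p \<in> V" "q \<in> V" "p \<noteq> q" using pq by (auto simp: V_def)
      then show "F p q = G p q"
      proof cases
        case 4
        then have "\<not> c.blue p q" using nb by (simp add: V_def F_def G_def)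
        then show ?thesis using c.pair[OF 4] unfolding flipped_def by metis
      qed (use border dg pq in auto)
    qed
  next
    assume nr: "\<forall>p\<in>U - {b}. \<forall>q\<in>U - {b}. \<not> kept (nrm b f) (nrm b g) p q"
    have "pdet (\<lambda>p q. F q p) U = pdet G U"
    proof (rule pdet_cong)
      fix p q assume pq: "p \<in> U" "q \<in> U"
      consider "p = b" | "q = b" | "p = q" | "p \<in> V" "q \<in> V" "p \<noteq> q" using pq by (auto simp: V_def)
      then show "F q p = G p q"
      proof cases
        case 4
        then have "\<not> c.red p q" using nr by (simp add: V_def F_def G_def)
        then show ?thesis using c.pair[OF 4] unfolding kept_def by metis
      qed (use border dg pq in metis)+
    qed
    then show ?thesis using pdet_transpose[OF fin, of F] by simp
  qed
  then show ?thesis using pdet_nrm_eq_iff[OF b _ fin] by (simp add: F_def G_def)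
qed

text \<open>\<open>pdet_clan_border\<close> gives both determinants as the same expression in
  diagonal entries and the minors on \<open>X\<close>, \<open>U - X\<close>,
  \<open>insert b X\<close> and \<open>insert x (U - X)\<close>. The size bounds make the last two
  proper.\<close>

lemma pdet_eq_if_common_clan:
  assumes b: "b \<in> U" and fin: "finite U" and X: "X \<subseteq> U - {b}" "2 \<le> card X" "2 \<le> card (U - X)"
    and proper: "\<And>T. T \<subset> U \<Longrightarrow> pdet f T = pdet g T"
    and F: "\<forall>u\<in>X. \<forall>v\<in>X. \<forall>y\<in>U - {b} - X. nrm b f u y = nrm b f v y \<and> nrm b f y u = nrm b f y v"
    and G: "\<forall>u\<in>X. \<forall>v\<in>X. \<forall>y\<in>U - {b} - X. nrm b g u y = nrm b g v y \<and> nrm b g y u = nrm b g y v"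
  shows "pdet f U = pdet g U"
proof -
  obtain x where x: "x \<in> X" using X(2) by fastforce
  have finX: "finite X" using X fin by (auto intro: finite_subset)
  have b': "b \<in> U - X" "X \<subseteq> U" "x \<noteq> b" using X x b by auto
  have sub: "pdet (nrm b f) T = pdet (nrm b g) T" if "T \<subset> U" for T
    using proper[OF that] pdet_nrm_eq_iff[OF b, of T] that fin by (auto dest: finite_subset)
  have sub1: "X \<subset> U" "U - X \<subset> U" using b' x by auto
  have "insert b X \<noteq> U"
  proof
    assume "insert b X = U"
    then have "U - X = {b}" using b' by auto
    then show False using X(3) by simp
  qed
  then have sub2: "insert b X \<subset> U" using b' by auto
  have "insert x (U - X) \<noteq> U"
  proof
    assume "insert x (U - X) = U"
    then have "X = {x}" using b' x by auto
    then show False using X(2) by simp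
  qed
  then have sub3: "insert x (U - X) \<subset> U" using b' x by auto
  have h: "pdet (nrm b h) U = (nrm b h b b * pdet (nrm b h) X - pdet (nrm b h) (insert b X)) *
      pdet (nrm b h) (insert x (U - X)) + (pdet (nrm b h) X - nrm b h x x *
        (nrm b h b b * pdet (nrm b h) X - pdet (nrm b h) (insert b X))) * pdet (nrm b h) (U - X)"
    if H: "\<forall>u\<in>X. \<forall>v\<in>X. \<forall>y\<in>U - {b} - X. nrm b h u y = nrm b h v y \<and> nrm b h y u = nrm b h y v" for h :: "'v \<Rightarrow> 'v \<Rightarrow> 'a"
  proof (rule pdet_clan_border[OF fin b'(2) x b'(1)])
    fix u y assume uy: "u \<in> X" "y \<in> U - X"
    have "nrm b h u y = nrm b h x y \<and> nrm b h y u = nrm b h y x"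
    proof (cases "y = b")
      case True
      then show ?thesis using X uy x by (auto simp: nrm_def)
    next
      case False
      then show ?thesis using H uy x by blast
    qed
    then show "nrm b h u y = nrm b h x y" "nrm b h y u = nrm b h y x" by auto
  qed (use b' in \<open>auto simp: nrm_def\<close>)
  have "pdet (nrm b f) U = pdet (nrm b g) U"
    unfolding h[OF F] h[OF G] using sub[OF sub1(1)] sub[OF sub1(2)] sub[OF sub2] sub[OF sub3]
      nrm_diag[OF b b] nrm_diag[OF b, of x] b' x by auto
  then show ?thesis using pdet_nrm_eq_iff[OF b _ fin] by simp
qed


lemma nrm_neutral_base:
  assumes b: "b \<in> U" "x \<in> U" "x \<noteq> b" and p: "p \<in> U - {b, x}" "q \<in> U - {b, x}"
    and n: "neutral (nrm b f) x p" "neutral (nrm b f) x q"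
  shows "nrm x f p q = nrm b f p q / (nrm b f x p * nrm b f x q * (f b x * f x b))"
    and "nrm x g p q = nrm b g p q / (nrm b f x p * nrm b f x q * (f b x * f x b))"
proof -
  interpret c: coloured "U - {b}" "nrm b f" "nrm b g" by (rule coloured_nrm[OF b(1)])
  have "nrm b g p x = nrm b f x p" "nrm b g x q = nrm b f x q" "nrm b f p x = nrm b f x p"
    using c.pair[of x p] c.pair[of x q] n p b by (auto simp: neutral_def)
  then show "nrm x f p q = nrm b f p q / (nrm b f x p * nrm b f x q * (f b x * f x b))"
    and "nrm x g p q = nrm b g p q / (nrm b f x p * nrm b f x q * (f b x * f x b))"
    using nrm_base[OF b p] by simp_all
qed

text \<open>When the new base is neutral to \<open>p\<close> and \<open>q\<close>, the scaling
  factor is symmetric in \<open>p, q\<close> and common to both matrices.\<close>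

lemma colour_neutral_base:
  assumes b: "b \<in> U" "x \<in> U" "x \<noteq> b" and p: "p \<in> U - {b, x}" "q \<in> U - {b, x}"
    and n: "neutral (nrm b f) x p" "neutral (nrm b f) x q"
  shows "kept (nrm x f) (nrm x g) p q = kept (nrm b f) (nrm b g) p q"
    and "flipped (nrm x f) (nrm x g) p q = flipped (nrm b f) (nrm b g) p q"
proof -
  interpret c: coloured "U - {b}" "nrm b f" "nrm b g" by (rule coloured_nrm[OF b(1)])
  let ?k = "nrm b f x p * nrm b f x q * (f b x * f x b)"
  have "?k \<noteq> 0"
    using c.nonzero[of x p] c.nonzero[of x q] nz[of b x] nz[of x b] p b by auto
  moreover have "nrm x f p q = nrm b f p q / ?k" "nrm x f q p = nrm b f q p / ?k"
    "nrm x g p q = nrm b g p q / ?k" "nrm x g q p = nrm b g q p / ?k"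
    using nrm_neutral_base[OF b p n] nrm_neutral_base[OF b p(2,1) n(2,1)]
    by (simp_all add: mult.commute)
  ultimately show "kept (nrm x f) (nrm x g) p q = kept (nrm b f) (nrm b g) p q"
    and "flipped (nrm x f) (nrm x g) p q = flipped (nrm b f) (nrm b g) p q"
    unfolding kept_def flipped_def by simp_all
qed

text \<open>Here \<open>j, k\<close> are twins of \<open>f\<close> that the vertex \<open>i\<close> tells apart in \<open>g\<close>.
  In \<open>g\<close> the vertex \<open>i\<close> then lies between \<open>j\<close> and \<open>k\<close>, and no further vertex separates it from them.\<close>

lemma between_twins:
  assumes b: "b \<in> U" and V: "i \<in> U - {b}" "j \<in> U - {b}" "k \<in> U - {b}" "x \<in> U - {b}"
      "i \<noteq> j" "i \<noteq> k" "i \<noteq> x" "j \<noteq> k" "j \<noteq> x" "k \<noteq> x"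
    and col: "kept (nrm b f) (nrm b g) i j" "flipped (nrm b f) (nrm b g) i k" "kept (nrm b f) (nrm b g) j k"
    and twin: "nrm b f j i = nrm b f k i" "nrm b f i j = nrm b f i k"
      "nrm b f j x = nrm b f k x" "nrm b f x j = nrm b f x k"
    and gx: "nrm b g j x = nrm b g k x"
  shows "nrm b g i x = nrm b g j x"
proof -
  define V F G where "V = U - {b}" and "F = nrm b f" and "G = nrm b g"
  interpret c: coloured V F G unfolding V_def F_def G_def by (rule coloured_nrm[OF b])
  note V = V[folded V_def] and col = col[folded F_def G_def] and twin = twin[folded F_def]
    and gx = gx[folded G_def]
  have "G i x = G j x"
  proof (cases "c.neut x j")
    case True
    then have xk: "c.neut x k" using twin unfolding neutral_def by metis
    have "\<not> c.blue x i" using c.no_rainbow[of j i x] True V col c.red_commute c.blue_commute c.neut_commute by metis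
    moreover have "\<not> c.red x i" using c.no_rainbow[of x i k] xk V col by metis
    ultimately have xi: "c.neut x i" using c.colours[of x i] V by metis
    have xb: "x \<in> U" "x \<noteq> b" and U: "i \<in> U - {b, x}" "j \<in> U - {b, x}" "k \<in> U - {b, x}"
      using V by (auto simp: V_def)
    note n = True[unfolded F_def] xk[unfolded F_def] xi[unfolded F_def]
    \<comment> \<open>The triangle \<open>j, i, k\<close> keeps its colours at base
      \<open>x\<close>, so \<open>i\<close> and \<open>k\<close> are twins as seen from
      \<open>j\<close> for both bases. Comparing the two normalisations leaves
      \<open>F x i = F x k\<close>.\<close>
    interpret cx: coloured "U - {x}" "nrm x f" "nrm x g" by (rule coloured_nrm[OF xb(1)])
    have "cx.red j i" "cx.red j k" "cx.blue i k"
      using colour_neutral_base[OF b xb U(2) U(1) n(1) n(3)] colour_neutral_base[OF b xb U(2) U(3) n(1) n(2)]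
        colour_neutral_base[OF b xb U(1) U(3) n(3) n(2)] col c.red_commute[of i j]
      by (simp_all add: F_def G_def)
    then have "nrm x f j i = nrm x f j k" using cx.twins_red[of j i k] V U by auto
    moreover have "F j i = F j k" using c.twins_red[of j i k] V col c.red_commute[of i j] by metis
    moreover have "F j i \<noteq> 0" "F x i \<noteq> 0" "F x j \<noteq> 0" "F x k \<noteq> 0" using c.nonzero V by auto
    moreover have "f b x * f x b \<noteq> 0" using nz[of b x] nz[of x b] b xb by auto
    ultimately have "F x i = F x k"
      using nrm_neutral_base(1)[OF b xb U(2) U(1) n(1) n(3)] nrm_neutral_base(1)[OF b xb U(2) U(3) n(1) n(2)]
      by (simp add: F_def)
    moreover have "G i x = F x i" "G j x = F x j"
      using c.pair[of x i] c.pair[of x j] V xi True unfolding neutral_def by metis+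
    ultimately show ?thesis using twin by simp
  next
    case False
    then have "\<not> c.neut x k" using twin unfolding neutral_def by metis
    then have cs: "c.red x j \<and> c.red x k \<or> c.blue x j \<and> c.blue x k"
      using c.colours[of x j] c.colours[of x k] False V twin gx unfolding kept_def flipped_def neutral_def
      by metis
    then have "\<not> c.neut x i"
      using c.no_rainbow[of x k i] c.no_rainbow[of i j x] V col c.red_commute c.blue_commute c.neut_commute
      by metis
    then consider "c.red x j" "c.red x k" "c.red x i" | "c.red x j" "c.red x k" "c.blue x i"
      | "c.blue x j" "c.blue x k" "c.red x i" | "c.blue x j" "c.blue x k" "c.blue x i"
      using cs c.colours[of x i] V by metis
    then show ?thesis
    proof cases
      case 1
      then have "F i x = F k x" using c.twins_red[of x i k] V col by metis
      then show ?thesis using 1 twin unfolding kept_def by metis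
    next
      case 2
      have "F j x = F j i" using c.twins_red[of j x i] 2 V col c.red_commute by metis
      moreover have "F x i = F k i"
        using c.twins_blue[of i x k] 2 V col c.red_commute c.blue_commute by metis
      ultimately show ?thesis using 2 twin unfolding kept_def flipped_def by metis
    next
      case 3
      have "F x k = F i k" using c.twins_blue[of k x i] 3 V col c.red_commute c.blue_commute by metis
      moreover have "F i x = F i j"
        using c.twins_red[of i x j] 3 V col c.red_commute c.blue_commute by metis
      ultimately show ?thesis using 3 twin unfolding kept_def flipped_def by metis
    next
      case 4
      then have "F x i = F x j" using c.twins_blue[of x i j] V col by metis
      then show ?thesis using 4 unfolding flipped_def by metis
    qed
  qed
  then show ?thesis by (simp add: G_def)
qed

text \<open>With diagonal entries \<open>F k j\<close> at \<open>j\<close> and \<open>F j k\<close> at \<open>k\<close>, rows \<open>j\<close> and \<open>k\<close> of \<open>F\<close> coincide, while in \<open>G\<close>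
  the differences with row \<open>k\<close> of the rows in \<open>I\<close> and of row \<open>j\<close> are supported on the columns \<open>I\<close>.\<close>

lemma pdet_eq_if_red_twins:
  assumes b: "b \<in> U" and fin: "finite U" and jk: "j \<in> U - {b}" "k \<in> U - {b}" "j \<noteq> k"
    and proper: "\<And>T. T \<subset> U \<Longrightarrow> pdet f T = pdet g T"
    and twin: "\<And>y. y \<in> U - {b} - {j, k} \<Longrightarrow> nrm b f j y = nrm b f k y \<and> nrm b f y j = nrm b f y k"
    and red: "kept (nrm b f) (nrm b g) j k"
  shows "pdet f U = pdet g U"
proof -
  define V F G where "V = U - {b}" and "F = nrm b f" and "G = nrm b g"
  interpret c: coloured V F G unfolding V_def F_def G_def by (rule coloured_nrm[OF b])
  \<comment> \<open>These are the vertices at which the twins \<open>j, k\<close> of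
    \<open>F\<close> come apart in \<open>G\<close>: one of the two edges is kept, the other
    flipped.\<close>
  define I where "I = {i \<in> V - {j, k}. c.red i j \<and> c.blue i k \<or> c.blue i j \<and> c.red i k}"
  have jkV: "j \<in> V" "k \<in> V" "j \<noteq> k" using jk by (auto simp: V_def)
  have tw: "F j y = F k y" "F y j = F y k" if "y \<in> V - {j, k}" for y
    using twin[of y] that by (auto simp: V_def F_def)
  have red: "c.red j k" "c.red k j" using red c.red_commute by (auto simp: F_def G_def)
  have Gjk: "G j k = F j k" "G k j = F k j" using red by (auto simp: kept_def)
  have row_b: "F p b = 1" "G p b = 1" if "p \<in> V" for p using that by (auto simp: F_def G_def nrm_def V_def)
  have I1: "G i j = F k j" "G i k = F j k" if iI: "i \<in> I" for i
  proof -
    have i: "i \<in> V - {j, k}" "i \<in> V" "i \<noteq> j" "i \<noteq> k" using iI by (auto simp: I_def)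
    consider "c.red i j" "c.blue i k" | "c.blue i j" "c.red i k" using iI by (auto simp: I_def)
    then have "G i j = F k j \<and> G i k = F j k"
    proof cases
      case 1
      have "F j i = F j k" "F i j = F k j"
        using c.twins_red[of j i k] 1 i(2-4) jkV red c.red_commute[of i j] by metis+
      then show ?thesis using 1 tw[OF i(1)] unfolding kept_def flipped_def by metis
    next
      case 2
      have "F k i = F k j" "F i k = F j k"
        using c.twins_red[of k i j] 2 i(2-4) jkV red c.red_commute[of i k] by metis+
      then show ?thesis using 2 tw[OF i(1)] unfolding kept_def flipped_def by metis
    qed
    then show "G i j = F k j" "G i k = F j k" by auto
  qed
  have out1: "G j x = G k x" if "x \<in> V - {j, k} - I" for x
  proof -
    have x: "x \<in> V - {j, k}" "x \<in> V" "x \<noteq> j" "x \<noteq> k" using that by auto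
    have "\<not> (c.red x j \<and> c.blue x k \<or> c.blue x j \<and> c.red x k)" using that by (auto simp: I_def)
    then show ?thesis
      using c.colours[of x j] c.colours[of x k] c.pair[of x j] c.pair[of x k] x(2-4) jkV tw[OF x(1)]
      unfolding kept_def flipped_def neutral_def by metis
  qed
  have out2: "G i x = G k x" if iI: "i \<in> I" and x: "x \<in> V - {j, k} - I" for i x
  proof -
    have d: "i \<in> V" "x \<in> V" "i \<noteq> j" "i \<noteq> k" "x \<noteq> j" "x \<noteq> k" "i \<noteq> x"
      using iI x by (auto simp: I_def)
    have t: "F j i = F k i" "F i j = F i k" "F j x = F k x" "F x j = F x k" "G j x = G k x"
      using tw[of i] tw[of x] out1[OF x] d by auto
    consider "c.red i j" "c.blue i k" | "c.red i k" "c.blue i j" using iI by (auto simp: I_def)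
    then show ?thesis
    proof cases
      case 1
      then show ?thesis
        using between_twins[OF b, of i j k x] t d jkV red unfolding F_def G_def V_def by auto
    next
      case 2
      then show ?thesis
        using between_twins[OF b, of i k j x] t d jkV red unfolding F_def G_def V_def by auto
    qed
  qed
  \<comment> \<open>In \<open>F\<close> these two values are forced if rows \<open>j\<close> and
    \<open>k\<close> are to agree in columns \<open>j\<close> and \<open>k\<close>. By
    \<open>I1\<close> and \<open>Gjk\<close> the same values make rows \<open>j\<close>,
    \<open>k\<close> and those of \<open>I\<close> agree there in \<open>G\<close>.\<close>
  let ?ch = "\<lambda>H p q. if p = j \<and> q = j then F k j else if p = k \<and> q = k then F j k else H p q"
  have jkU: "j \<in> U" "k \<in> U" "j \<noteq> k" using jk by auto
  have "pdet (?ch F) U = 0"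
  proof (rule pdet_identical_rows[OF fin jkU])
    fix q assume "q \<in> U"
    then consider "q = b" | "q = j" | "q = k" | "q \<in> V - {j, k}" by (auto simp: V_def)
    then show "?ch F j q = ?ch F k q" using jkV jk row_b tw by cases auto
  qed
  moreover have "pdet (?ch G) U = 0"
  proof -
    let ?T = "insert j I"
    have IU: "I \<subseteq> U" "j \<notin> I" "k \<notin> I" by (auto simp: I_def V_def)
    have finI: "finite I" using IU fin by (auto intro: finite_subset)
    have "pdet (\<lambda>p q. if p \<in> ?T then ?ch G p q - ?ch G k q else ?ch G p q) U = 0"
    proof (rule pdet_zero_block[OF fin, of ?T I])
      fix p q assume p: "p \<in> ?T" and "q \<in> U - I"
      then consider "q = b" | "q = j" | "q = k" | "q \<in> V - {j, k} - I" by (auto simp: V_def)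
      then have "?ch G p q = ?ch G k q"
      proof cases
        case 1
        have "p \<in> V" using p jkV by (auto simp: I_def)
        then show ?thesis using 1 jk jkV row_b by auto
      next
        case 2
        then show ?thesis using p I1 Gjk jkV IU by auto
      next
        case 3
        then show ?thesis using p I1 Gjk jkV IU by auto
      next
        case 4
        then show ?thesis using p out1[OF 4] out2[OF _ 4] jkV by auto
      qed
      then show "(if p \<in> ?T then ?ch G p q - ?ch G k q else ?ch G p q) = 0" using p by simp
    qed (use IU finI jkU in auto)
    then show ?thesis
      using pdet_subtract_row[OF fin jkU(2), of ?T "?ch G"] IU jkU by simp
  qed
  ultimately have eq: "pdet (?ch F) U = pdet (?ch G) U" by simp
  have "pdet F U = pdet G U"
  proof (rule pdet_eq_by_diag[OF fin jkU _ _ _ eq])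
    show "F j j = G j j" "F k k = G k k" using nrm_diag[OF b] jkU by (auto simp: F_def G_def)
    show "pdet F T = pdet G T" if "T \<subset> U" for T
      using proper[OF that] pdet_nrm_eq_iff[OF b, of T] that fin
      by (auto simp: F_def G_def dest: finite_subset)
  qed
  then show ?thesis using pdet_nrm_eq_iff[OF b _ fin] by (simp add: F_def G_def)
qed

text \<open>A vertex seeing a clan without blue edges in both colours would cut it into two smaller clans.\<close>

lemma red_set_common_clan:
  assumes b: "b \<in> U" and fin: "finite U"
    and X: "X \<subseteq> U - {b}" "3 \<le> card X" "2 \<le> card (U - X)" and clan: "clan U f X"
    and min: "\<And>Z. clan U f Z \<Longrightarrow> 2 \<le> card Z \<Longrightarrow> 2 \<le> card (U - Z) \<Longrightarrow> card X \<le> card Z"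
    and nb: "\<forall>p\<in>X. \<forall>q\<in>X. \<not> flipped (nrm b f) (nrm b g) p q"
  shows "\<forall>u\<in>X. \<forall>v\<in>X. \<forall>y\<in>U - {b} - X. nrm b g u y = nrm b g v y \<and> nrm b g y u = nrm b g y v"
proof (intro ballI)
  define V F G where "V = U - {b}" and "F = nrm b f" and "G = nrm b g"
  interpret c: coloured V F G unfolding V_def F_def G_def by (rule coloured_nrm[OF b])
  have tw: "F u y = F v y" "F y u = F y v" if "u \<in> X" "v \<in> X" "y \<in> V - X" for u v y
    using clan that unfolding clan_nrm[OF b X(1)] F_def V_def by blast+
  have nb: "\<not> c.blue p q" if "p \<in> X" "q \<in> X" for p q using nb that by (auto simp: F_def G_def)
  have XV: "X \<subseteq> V" using X by (simp add: V_def)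
  have finX: "finite X" using XV fin by (auto simp: V_def intro: finite_subset)
  \<comment> \<open>Uniformity inside \<open>X\<close> suffices, since vertices outside already see
    \<open>X\<close> uniformly. A proper subset with two or more elements would be a smaller clan of
    \<open>U\<close>.\<close>
  have small: "card Z \<le> 1" if Z: "Z \<subset> X"
    and tZ: "\<And>u v y. u \<in> Z \<Longrightarrow> v \<in> Z \<Longrightarrow> y \<in> X - Z \<Longrightarrow> F u y = F v y \<and> F y u = F y v" for Z
  proof (rule ccontr)
    assume "\<not> card Z \<le> 1"
    have ZV: "Z \<subseteq> U - {b}" using Z X by auto
    have "F u y = F v y \<and> F y u = F y v" if u: "u \<in> Z" "v \<in> Z" and y: "y \<in> V - Z" for u v y
    proof (cases "y \<in> X")
      case True
      then show ?thesis using tZ u y by blast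
    next
      case False
      then show ?thesis using tw[of u v y] u y Z by blast
    qed
    then have "clan U f Z" unfolding clan_nrm[OF b ZV] F_def V_def by blast
    moreover have "card (U - X) \<le> card (U - Z)" using Z fin by (intro card_mono) auto
    ultimately have "card X \<le> card Z" using min[of Z] X(3) \<open>\<not> card Z \<le> 1\<close> by auto
    moreover have "card Z < card X" using Z finX by (rule psubset_card_mono[rotated])
    ultimately show False by simp
  qed
  fix u v i assume u: "u \<in> X" and v: "v \<in> X" and "i \<in> U - {b} - X"
  then have i: "i \<in> V - X" "i \<in> V" by (auto simp: V_def)
  have ix: "i \<noteq> x" if "x \<in> X" for x using i that by auto
  define XR XB where "XR = {x \<in> X. c.red i x}" and "XB = {x \<in> X. c.blue i x}"
  have disj: "XR \<inter> XB = {}" by (auto simp: XR_def XB_def kept_def flipped_def)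
  have mono: "XR = {} \<or> XB = {}"
  proof (rule ccontr)
    assume "\<not> (XR = {} \<or> XB = {})"
    then obtain r s where r: "r \<in> XR" and s: "s \<in> XB" by auto
    \<comment> \<open>Without blue edges in \<open>X\<close> only one alternative of
      \<open>chain_red_blue\<close> is left. It fixes the weights between the two classes, so each
      class is uniform as seen from the other.\<close>
    have rs: "F x z = F r i \<and> F z x = F i r" if "x \<in> XR" "z \<in> XB" for x z
    proof -
      have xz: "x \<in> X" "z \<in> X" "r \<in> X" "c.red i x" "c.blue i z" "x \<noteq> z"
        using that r disj by (auto simp: XR_def XB_def)
      then have "F x i = F x z" "F i x = F z x"
        using c.chain_red_blue[of i x z] nb[of z x] XV i ix by blast+
      then show ?thesis using tw[OF xz(1,3) i(1)] by simp
    qed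
    \<comment> \<open>By \<open>tw\<close> the vertex \<open>i\<close> sees \<open>X\<close>
      uniformly, so one asymmetric edge makes all edges from \<open>i\<close> to \<open>X\<close>
      asymmetric.\<close>
    have "\<not> c.neut i r" using r by (auto simp: XR_def kept_def neutral_def)
    then have "\<not> c.neut i x" if "x \<in> X" for x
      using tw[OF that _ i(1), of r] r by (simp add: XR_def neutral_def)
    then have XRB: "X = XR \<union> XB"
      using c.colours[of i] i XV ix unfolding XR_def XB_def by blast
    have "card XB \<le> 1"
    proof (rule small)
      show "XB \<subset> X" using XRB r disj by blast
      show "F u y = F v y \<and> F y u = F y v" if "u \<in> XB" "v \<in> XB" "y \<in> X - XB" for u v y
        using rs[of y u] rs[of y v] that XRB by auto
    qed
    moreover have "card XR \<le> 1"
    proof (rule small)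
      show "XR \<subset> X" using XRB s disj by blast
      show "F u y = F v y \<and> F y u = F y v" if "u \<in> XR" "v \<in> XR" "y \<in> X - XR" for u v y
        using rs[of u y] rs[of v y] that XRB by auto
    qed
    moreover have "card X = card XR + card XB"
      unfolding XRB by (rule card_Un_disjoint) (use finX disj in \<open>auto simp: XR_def XB_def\<close>)
    ultimately show False using X(2) by simp
  qed
  have pu: "G i u = F i u \<and> G u i = F u i \<or> G i u = F u i \<and> G u i = F i u"
    and pv: "G i v = F i v \<and> G v i = F v i \<or> G i v = F v i \<and> G v i = F i v"
    using c.pair[of i u] c.pair[of i v] i u v XV ix by blast+
  from mono have "G u i = G v i \<and> G i u = G i v"
  proof
    assume "XR = {}"
    then have "\<not> c.red i u" "\<not> c.red i v" using u v by (auto simp: XR_def)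
    then have "G u i = F i u" "G i u = F u i" "G v i = F i v" "G i v = F v i"
      using pu pv unfolding kept_def by metis+
    then show ?thesis using tw[OF u v i(1)] by simp
  next
    assume "XB = {}"
    then have "\<not> c.blue i u" "\<not> c.blue i v" using u v by (auto simp: XB_def)
    then have "G u i = F u i" "G i u = F i u" "G v i = F v i" "G i v = F i v"
      using pu pv unfolding flipped_def by metis+
    then show ?thesis using tw[OF u v i(1)] by simp
  qed
  then show "nrm b g u i = nrm b g v i \<and> nrm b g i u = nrm b g i v" by (simp add: G_def)
qed

lemma pdet_step:
  assumes fin: "finite U" and proper: "\<And>T. T \<subset> U \<Longrightarrow> pdet f T = pdet g T"
  shows "pdet f U = pdet g U"
proof (cases "\<exists>X. clan U f X \<and> 2 \<le> card X \<and> 2 \<le> card (U - X)")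
  case False
  show ?thesis
  proof (cases "U = {}")
    case False
    then obtain b where b: "b \<in> U" by auto
    have irr: "\<not> kept F G p p" "\<not> flipped F G p p" for F G :: "'v \<Rightarrow> 'v \<Rightarrow> 'a" and p
      by (auto simp: kept_def flipped_def)
    show ?thesis
    proof (rule ccontr)
      assume "pdet f U \<noteq> pdet g U"
      then obtain p q r s where "p \<in> U - {b}" "q \<in> U - {b}" "kept (nrm b f) (nrm b g) p q"
        "r \<in> U - {b}" "s \<in> U - {b}" "flipped (nrm b f) (nrm b g) r s"
        using pdet_eq_if_unicoloured[OF b fin] by blast
      then show False
        using clan_of_red_blue[OF fin b, of p q r s] irr \<open>\<nexists>X. _ X\<close> by blast
    qed
  qed simp
next
  case True
  define P where "P X \<longleftrightarrow> clan U f X \<and> 2 \<le> card X \<and> 2 \<le> card (U - X)" for X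
  obtain X where X: "P X" and min: "\<And>Z. P Z \<Longrightarrow> card X \<le> card Z"
    using True ex_has_least_nat[of P _ card] unfolding P_def by metis
  have XU: "X \<subseteq> U" using X by (simp add: P_def clan_def)
  have "U - X \<noteq> {}" using X unfolding P_def by (metis card.empty not_numeral_le_zero)
  then obtain b where b: "b \<in> U" "b \<notin> X" by auto
  have X': "X \<subseteq> U - {b}" "2 \<le> card X" "2 \<le> card (U - X)" and cl: "clan U f X"
    using X XU b by (auto simp: P_def)
  have finX: "finite X" using XU fin by (rule finite_subset)
  interpret sw: minors U f "\<lambda>p q. g q p" by (rule minors_swap)
  have trans: "pdet (\<lambda>p q. g q p) T = pdet g T" if "T \<subseteq> U" for T
    using pdet_transpose[of T g] that fin finite_subset by blast
  have tw: "\<forall>u\<in>X. \<forall>v\<in>X. \<forall>y\<in>U - {b} - X. nrm b f u y = nrm b f v y \<and> nrm b f y u = nrm b f y v"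
    using cl unfolding clan_nrm[OF b(1) X'(1)] .
  show ?thesis
  proof (cases "3 \<le> card X")
    case True
    have mono: "(\<forall>p\<in>X. \<forall>q\<in>X. \<not> flipped (nrm b f) (nrm b g) p q) \<or>
        (\<forall>p\<in>X. \<forall>q\<in>X. \<not> kept (nrm b f) (nrm b g) p q)"
    proof (rule ccontr)
      assume "\<not> ?thesis"
      then obtain p q r s where pq: "p \<in> X" "q \<in> X" "kept (nrm b f) (nrm b g) p q"
        and rs: "r \<in> X" "s \<in> X" "flipped (nrm b f) (nrm b g) r s" by blast
      then have "p \<noteq> q" "r \<noteq> s" by (auto simp: kept_def flipped_def)
      \<comment> \<open>On \<open>X\<close> together with the base both colours occur, which yields
        a clan of \<open>W\<close>. It or its complement avoids \<open>b\<close>, and it is then a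
        clan of \<open>U\<close>, because vertices outside \<open>X\<close> see \<open>X\<close>
        uniformly.\<close>
      define W where "W = insert b X"
      interpret sub: minors W f g by (rule minors_subset) (use b XU in \<open>auto simp: W_def\<close>)
      have finW: "finite W" "b \<in> W" "W - {b} = X" using finX b by (auto simp: W_def)
      obtain Z0 where Z0: "clan W f Z0" "2 \<le> card Z0" "2 \<le> card (W - Z0)"
        using sub.clan_of_red_blue[OF finW(1,2), of p q r s] pq rs \<open>p \<noteq> q\<close> \<open>r \<noteq> s\<close> finW by auto
      have "Z0 \<subseteq> W" using Z0 by (simp add: clan_def)
      then have WZ: "W - (W - Z0) = Z0" by auto
      obtain Z where Z: "clan W f Z" "2 \<le> card Z" "2 \<le> card (W - Z)" "b \<notin> Z"
        using Z0 clan_complement[OF Z0(1)] WZ finW(2)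
        by (cases "b \<in> Z0") (auto intro: that[of Z0] that[of "W - Z0"])
      have ZW: "Z \<subseteq> W" using Z by (simp add: clan_def)
      then have ZX: "Z \<subseteq> X" "Z \<subseteq> W - {b}" "Z \<subseteq> U - {b}" using Z(4) X'(1) by (auto simp: W_def)
      have twZ: "\<forall>u\<in>Z. \<forall>v\<in>Z. \<forall>y\<in>W - {b} - Z. nrm b f u y = nrm b f v y \<and> nrm b f y u = nrm b f y v"
        using Z(1) unfolding sub.clan_nrm[OF finW(2) ZX(2)] .
      have "nrm b f u y = nrm b f v y \<and> nrm b f y u = nrm b f y v"
        if "u \<in> Z" "v \<in> Z" "y \<in> U - {b} - Z" for u v y
        using twZ tw that ZX(1) unfolding finW(3) by (cases "y \<in> X") blast+
      then have "clan U f Z" unfolding clan_nrm[OF b(1) ZX(3)] by blast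
      moreover have "card (U - X) \<le> card (U - Z)" using ZX fin by (intro card_mono) auto
      ultimately have "card X \<le> card Z" using min[of Z] X'(3) Z(2) by (auto simp: P_def)
      \<comment> \<open>\<open>W\<close> has one element more than \<open>X\<close>, so two elements
        outside \<open>Z\<close> already force \<open>Z\<close> to be smaller than
        \<open>X\<close>.\<close>
      moreover have "card (W - Z) = Suc (card X) - card Z"
        using card_Diff_subset[of Z W] ZW finW b finX by (auto simp: W_def finite_subset)
      ultimately show False using Z(3) by simp
    qed
    have min': "card X \<le> card Z" if "clan U f Z" "2 \<le> card Z" "2 \<le> card (U - Z)" for Z
      using min that by (simp add: P_def)
    from mono show ?thesis
    proof
      assume nb: "\<forall>p\<in>X. \<forall>q\<in>X. \<not> flipped (nrm b f) (nrm b g) p q"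
      have common: "\<forall>u\<in>X. \<forall>v\<in>X. \<forall>y\<in>U - {b} - X.
          nrm b g u y = nrm b g v y \<and> nrm b g y u = nrm b g y v"
        by (rule red_set_common_clan[OF b(1) fin X'(1) True X'(3) cl _ nb]) (rule min')
      show ?thesis
        by (rule pdet_eq_if_common_clan[OF b(1) fin X' _ tw common]) (rule proper)
    next
      assume "\<forall>p\<in>X. \<forall>q\<in>X. \<not> kept (nrm b f) (nrm b g) p q"
      then have nb: "\<forall>p\<in>X. \<forall>q\<in>X. \<not> flipped (nrm b f) (nrm b (\<lambda>p q. g q p)) p q"
        unfolding nrm_transpose[of b g] flipped_swap[of "nrm b f" "nrm b g"] .
      have common: "\<forall>u\<in>X. \<forall>v\<in>X. \<forall>y\<in>U - {b} - X. nrm b (\<lambda>p q. g q p) u y = nrm b (\<lambda>p q. g q p) v y \<and>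
          nrm b (\<lambda>p q. g q p) y u = nrm b (\<lambda>p q. g q p) y v"
        by (rule sw.red_set_common_clan[OF b(1) fin X'(1) True X'(3) cl _ nb]) (rule min')
      have "pdet f U = pdet (\<lambda>p q. g q p) U"
      proof (rule sw.pdet_eq_if_common_clan[OF b(1) fin X' _ tw common])
        show "pdet f T = pdet (\<lambda>p q. g q p) T" if "T \<subset> U" for T
          using proper[OF that] trans[of T] that by auto
      qed
      then show ?thesis using trans[of U] by simp
    qed
  next
    case False
    then have "card X = 2" using X' by simp
    then obtain j k where jk: "X = {j, k}" "j \<noteq> k" by (auto simp: card_2_iff)
    have jkV: "j \<in> U - {b}" "k \<in> U - {b}" using X' jk by auto
    have tw': "nrm b f j y = nrm b f k y \<and> nrm b f y j = nrm b f y k" if "y \<in> U - {b} - {j, k}" for y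
      using tw that unfolding jk by blast
    interpret c: coloured "U - {b}" "nrm b f" "nrm b g" by (rule coloured_nrm[OF b(1)])
    consider "c.red j k" | "c.blue j k" | "c.neut j k" using c.colours[OF jkV jk(2)] by blast
    then show ?thesis
    proof cases
      case 1
      show ?thesis
        by (rule pdet_eq_if_red_twins[OF b(1) fin jkV jk(2) _ _ 1]) (rule proper tw'; assumption)+
    next
      case 2
      then have r: "kept (nrm b f) (nrm b (\<lambda>p q. g q p)) j k"
        unfolding nrm_transpose[of b g] kept_swap[of "nrm b f" "nrm b g"] .
      have "pdet f U = pdet (\<lambda>p q. g q p) U"
      proof (rule sw.pdet_eq_if_red_twins[OF b(1) fin jkV jk(2) _ _ r])
        show "nrm b f j y = nrm b f k y \<and> nrm b f y j = nrm b f y k" if "y \<in> U - {b} - {j, k}" for y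
          by (rule tw'[OF that])
        show "pdet f T = pdet (\<lambda>p q. g q p) T" if "T \<subset> U" for T
          using proper[OF that] trans[of T] that by auto
      qed
      then show ?thesis using trans[of U] by simp
    next
      case 3
      \<comment> \<open>A vertex with edges of opposite colours to \<open>j\<close> and
        \<open>k\<close> would form with the neutral edge \<open>j k\<close> a triangle forbidden by
        \<open>no_rainbow\<close>; so \<open>j, k\<close> are twins in \<open>g\<close> too.\<close>
      have G: "nrm b g j y = nrm b g k y \<and> nrm b g y j = nrm b g y k" if y: "y \<in> U - {b} - {j, k}" for y
      proof -
        have d: "y \<in> U - {b}" "y \<noteq> j" "y \<noteq> k" using y by auto
        have "\<not> (c.red y j \<and> c.blue y k)" "\<not> (c.red y k \<and> c.blue y j)"
          using c.no_rainbow[of j y k] c.no_rainbow[of k y j] 3 d jkV jk(2)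
            c.red_commute c.neut_commute by metis+
        then show ?thesis
          using c.pair[of y j] c.pair[of y k] c.colours[of y j] c.colours[of y k] d jkV tw'[OF y]
          unfolding kept_def flipped_def neutral_def by metis
      qed
      have common: "\<forall>u\<in>X. \<forall>v\<in>X. \<forall>y\<in>U - {b} - X.
          nrm b g u y = nrm b g v y \<and> nrm b g y u = nrm b g y v"
        using G unfolding jk by auto
      show ?thesis
        by (rule pdet_eq_if_common_clan[OF b(1) fin X' _ tw common]) (rule proper)
    qed
  qed
qed

lemma pdet_eq:
  assumes "finite S" "S \<subseteq> U"
  shows "pdet f S = pdet g S"
  using assms
proof (induction S rule: finite_psubset_induct)
  case (psubset S)
  interpret sub: minors S f g by (rule minors_subset) (rule psubset.prems)
  show ?case by (rule sub.pdet_step) (use psubset in blast)+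
qed

end

section \<open>Rank-one submatrices and property R\<close>

lemma det_submatrix_2:
  assumes A: "A \<in> carrier_mat n m" and "i < j" "j < n" "k < l" "l < m"
  shows "det (submatrix A {i, j} {k, l}) = A $$ (i, k) * A $$ (j, l) - A $$ (i, l) * A $$ (j, k)"
proof -
  let ?M = "submatrix A {i, j} {k, l}"
  have c: "{a. a < n \<and> a \<in> {i, j}} = {i, j}" "{a. a < m \<and> a \<in> {k, l}} = {k, l}"
    using assms by auto
  have M: "?M \<in> carrier_mat 2 2"
    using assms by (intro carrier_matI; unfold dim_submatrix carrier_matD[OF A] c) auto
  have "?M = mat 2 2 (\<lambda>(r, s). ?M $$ (r, s))" using M by (intro eq_matI) auto
  then have "det ?M = pdet (\<lambda>r s. ?M $$ (r, s)) {0..<2}"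
    using pdet_eq_det[of id 2 "{0..<2}" "\<lambda>r s. ?M $$ (r, s)"] by simp
  also have "{0..<2::nat} = {0, 1}" by auto
  also have "pdet (\<lambda>r s. ?M $$ (r, s)) {0, 1} = ?M $$ (0, 0) * ?M $$ (1, 1) - ?M $$ (0, 1) * ?M $$ (1, 0)"
    by (rule pdet_2) simp
  finally have "det ?M = ?M $$ (0, 0) * ?M $$ (1, 1) - ?M $$ (0, 1) * ?M $$ (1, 0)" .
  moreover have e: "{a \<in> {i, j}. a < i} = {}" "{a \<in> {i, j}. a < j} = {i}"
    "{a \<in> {k, l}. a < k} = {}" "{a \<in> {k, l}. a < l} = {k}"
    using assms by auto
  have "?M $$ (0, 0) = A $$ (i, k)" "?M $$ (0, 1) = A $$ (i, l)"
    "?M $$ (1, 0) = A $$ (j, k)" "?M $$ (1, 1) = A $$ (j, l)"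
    using submatrix_index_card[of i A k "{i, j}" "{k, l}"] submatrix_index_card[of i A l "{i, j}" "{k, l}"]
      submatrix_index_card[of j A k "{i, j}" "{k, l}"] submatrix_index_card[of j A l "{i, j}" "{k, l}"]
      assms unfolding e by auto
  ultimately show ?thesis by simp
qed

text \<open>A nonzero minor of order 2 would force rank at least 2. \<open>submatrix\<close> lists
  indices increasingly, so only ordered pairs are read off directly; the other cases follow by
  commutativity.\<close>

lemma rank_1_minor:
  fixes A :: "'a::field mat"
  assumes A: "A \<in> carrier_mat n m" and rank: "mat_rank A = 1"
    and "i < n" "j < n" "k < m" "l < m"
  shows "A $$ (i, k) * A $$ (j, l) = A $$ (i, l) * A $$ (j, k)"
proof -
  have ordered: "A $$ (i, k) * A $$ (j, l) = A $$ (i, l) * A $$ (j, k)"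
    if "i < j" "j < n" "k < l" "l < m" for i j k l
  proof (rule ccontr)
    assume "A $$ (i, k) * A $$ (j, l) \<noteq> A $$ (i, l) * A $$ (j, k)"
    then have "det (submatrix A {i, j} {k, l}) \<noteq> 0" using det_submatrix_2[OF A that] by simp
    from vec_space.rank_gt_minor[OF A this] have "card {a. a < m \<and> a \<in> {k, l}} \<le> mat_rank A"
      using A by (simp add: mat_rank_def)
    moreover have "{a. a < m \<and> a \<in> {k, l}} = {k, l}" using that by auto
    ultimately show False using rank that by simp
  qed
  consider "i = j" | "k = l" | "i < j" "k < l" | "i < j" "l < k" | "j < i" "k < l" | "j < i" "l < k"
    by linarith
  then show ?thesis
  proof cases
    case 3
    then show ?thesis using ordered assms by blast
  next
    case 4
    then show ?thesis using ordered[of i j l k] assms by simp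
  next
    case 5
    then have "A $$ (j, k) * A $$ (i, l) = A $$ (j, l) * A $$ (i, k)" using ordered assms by blast
    then show ?thesis by (simp only: mult.commute)
  next
    case 6
    then have "A $$ (j, l) * A $$ (i, k) = A $$ (j, k) * A $$ (i, l)" using ordered assms by blast
    then show ?thesis by (simp only: mult.commute)
  qed (simp_all only: mult.commute)
qed

lemma rank_1_submatrix_minor:
  fixes A :: "'a::field mat"
  assumes A: "A \<in> carrier_mat n n" and rank: "mat_rank (submatrix A S T) = 1"
    and ij: "i \<in> S" "j \<in> S" "k \<in> T" "l \<in> T" "i < n" "j < n" "k < n" "l < n"
  shows "A $$ (i, k) * A $$ (j, l) = A $$ (i, l) * A $$ (j, k)"
proof -
  let ?M = "submatrix A S T"
  let ?r = "\<lambda>S i. card {a \<in> S. a < i}"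
  have r: "?r S i < card {a. a < n \<and> a \<in> S}" if "i \<in> S" "i < n" for i S
    by (rule psubset_card_mono) (use that in auto)
  have "?M \<in> carrier_mat (card {a. a < n \<and> a \<in> S}) (card {a. a < n \<and> a \<in> T})"
    using A by (intro carrier_matI) (simp_all add: dim_submatrix)
  from rank_1_minor[OF this rank r r r r, of i j k l] show ?thesis
    using ij A by (simp add: submatrix_index_card)
qed

text \<open>The order in which \<open>pick\<close> lists the indices is left open by writing each
  entry as a product of a row factor and a column factor, which bounds the rank by 1. A nonzero
  minor of order 1 gives the lower bound.\<close>

lemma rank_1_submatrix_2:
  fixes A :: "'a::field mat"
  assumes A: "A \<in> carrier_mat n n" and ij: "i < n" "j < n" "k < n" "l < n"
    and nz: "A $$ (i, k) \<noteq> 0" "A $$ (i, l) \<noteq> 0" "A $$ (j, k) \<noteq> 0" "A $$ (j, l) \<noteq> 0"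
    and eq: "A $$ (i, k) * A $$ (j, l) = A $$ (i, l) * A $$ (j, k)"
  shows "mat_rank (submatrix A {i, j} {k, l}) = 1"
proof -
  let ?M = "submatrix A {i, j} {k, l}"
  have c: "{a. a < n \<and> a \<in> {i, j}} = {i, j}" "{a. a < n \<and> a \<in> {k, l}} = {k, l}"
    using ij by auto
  have M: "?M \<in> carrier_mat (card {i, j}) (card {k, l})"
    by (intro carrier_matI; unfold dim_submatrix carrier_matD[OF A] c) (rule refl)+
  have pick: "pick {i, j} r \<in> {i, j}" "pick {k, l} s \<in> {k, l}" if "r < card {i, j}" "s < card {k, l}" for r s
    by (rule pick_in_set_le[OF that(1)], rule pick_in_set_le[OF that(2)])
  have ent: "?M $$ (r, s) = A $$ (pick {i, j} r, pick {k, l} s)" if "r < card {i, j}" "s < card {k, l}" for r s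
    by (rule submatrix_index; unfold carrier_matD[OF A] c) (use that in simp_all)
  have "mat_rank ?M \<le> 1"
  proof -
    have e: "?M $$ (r, s) = A $$ (pick {i, j} r, k) * (A $$ (i, pick {k, l} s) / A $$ (i, k))"
      if rs: "r < dim_row ?M" "s < dim_col ?M" for r s
    proof -
      have "r < card {i, j}" "s < card {k, l}" using rs M by auto
      then show ?thesis using ent[of r s] pick[of r s] eq nz by (auto simp: field_simps)
    qed
    show ?thesis
      unfolding mat_rank_def
      by (rule vec_space.rank_le_1_product_entries[where f = "\<lambda>r. A $$ (pick {i, j} r, k)"
            and g = "\<lambda>s. A $$ (i, pick {k, l} s) / A $$ (i, k)" and nc = "dim_col ?M"])
        (simp, rule e)
  qed
  moreover have "1 \<le> mat_rank ?M"
  proof -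
    have pos: "0 < card {i, j}" "0 < card {k, l}" by (simp_all add: card_gt_0_iff)
    let ?N = "submatrix ?M {0} {0}"
    have c0: "{a. a < card {i, j} \<and> a \<in> {0}} = {0}" "{a. a < card {k, l} \<and> a \<in> {0}} = {0}"
      using pos by auto
    have N: "?N \<in> carrier_mat 1 1"
      using dim_submatrix[of ?M "{0}" "{0}"] unfolding carrier_matD[OF M] c0 by (intro carrier_matI) simp_all
    have "?N $$ (0, 0) = ?M $$ (0, 0)"
      using submatrix_index_card[of 0 ?M 0 "{0}" "{0}"] M pos by auto
    also have "\<dots> \<noteq> 0" using ent[OF pos] pick[OF pos] nz by auto
    finally have "det ?N \<noteq> 0" using det_single[OF N] by simp
    from vec_space.rank_gt_minor[OF M this]
    have "card {a. a < card {k, l} \<and> a \<in> {0}} \<le> mat_rank ?M"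
      using M by (simp add: mat_rank_def)
    then show ?thesis unfolding c0 by simp
  qed
  ultimately show ?thesis by simp
qed

text \<open>For \<open>outc\<close> the cut has \<open>u, v\<close> on the row side and
  \<open>i, b\<close> on the column side; for \<open>inc\<close> the roles are exchanged. The side
  containing \<open>y\<close> decides which of the two equalities results.\<close>

lemma minors_of_property_R:
  fixes A B :: "'a::field mat"
  assumes A: "A \<in> carrier_mat n n" and R: "property_R n A"
    and eq: "\<And>S. S \<subseteq> {0..<n} \<Longrightarrow> card S \<le> 4 \<Longrightarrow>
      pdet (\<lambda>i k. A $$ (i, k)) S = pdet (\<lambda>i k. B $$ (i, k)) S"
  shows "minors {0..<n} (\<lambda>i k. A $$ (i, k)) (\<lambda>i k. B $$ (i, k))"
proof -
  define f g where "f = (\<lambda>i k. A $$ (i, k))" and "g = (\<lambda>i k. B $$ (i, k))"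
  let ?U = "{0..<n}"
  have eq: "pdet f S = pdet g S" if "S \<subseteq> ?U" "card S \<le> 4" for S
    using eq[OF that] by (simp add: f_def g_def)
  have fnz: "f p q \<noteq> 0" if "p \<in> ?U" "q \<in> ?U" "p \<noteq> q" for p q
    using R that unfolding property_R_def f_def by blast
  have diag: "f p p = g p p" if "p \<in> ?U" for p
    using eq[of "{p}"] that by simp
  have cyc2: "f p q * f q p = g p q * g q p" if "p \<in> ?U" "q \<in> ?U" "p \<noteq> q" for p q
    using eq[of "{p, q}"] that diag[of p] diag[of q] by (simp add: pdet_2)
  have cyc3: "f p q * f q r * f r p + f p r * f r q * f q p = g p q * g q r * g r p + g p r * g r q * g q p"
    if "p \<in> ?U" "q \<in> ?U" "r \<in> ?U" "distinct [p, q, r]" for p q r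
  proof -
    have "pdet f {p, q, r} = pdet g {p, q, r}" by (rule eq) (use that in auto)
    then show ?thesis
      using that diag[of p] diag[of q] diag[of r] cyc2[of p q] cyc2[of p r] cyc2[of q r]
      unfolding pdet_3[OF that(4)] by (simp add: mult.assoc)
  qed
  have cyc4: "f b p * f p q * f q r * f r b + f b p * f p r * f r q * f q b + f b q * f q p * f p r * f r b
      + f b q * f q r * f r p * f p b + f b r * f r p * f p q * f q b + f b r * f r q * f q p * f p b =
      g b p * g p q * g q r * g r b + g b p * g p r * g r q * g q b + g b q * g q p * g p r * g r b
      + g b q * g q r * g r p * g p b + g b r * g r p * g p q * g q b + g b r * g r q * g q p * g p b"
    if U: "b \<in> ?U" "p \<in> ?U" "q \<in> ?U" "r \<in> ?U" "distinct [b, p, q, r]" for b p q r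
  proof -
    have s: "pdet f {b, p, q, r} = pdet g {b, p, q, r}" "pdet f {p, q, r} = pdet g {p, q, r}"
      "pdet f {p, q} = pdet g {p, q}" "pdet f {p, r} = pdet g {p, r}" "pdet f {q, r} = pdet g {q, r}"
      by (rule eq; use U in auto)+
    have d: "f b b = g b b" "f p p = g p p" "f q q = g q q" "f r r = g r r" using diag U by auto
    have c2: "f b p * f p b = g b p * g p b" "f b q * f q b = g b q * g q b" "f b r * f r b = g b r * g r b"
      using cyc2 U by auto
    have c3: "f b p * f p q * f q b + f b q * f q p * f p b = g b p * g p q * g q b + g b q * g q p * g p b"
      "f b p * f p r * f r b + f b r * f r p * f p b = g b p * g p r * g r b + g b r * g r p * g p b"
      "f b q * f q r * f r b + f b r * f r q * f q b = g b q * g q r * g r b + g b r * g r q * g q b"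
      using cyc3[of b p q] cyc3[of b p r] cyc3[of b q r] U by auto
    \<comment> \<open>After rewriting, both sides are one common term minus the sum of the
      4-cycles.\<close>
    from s(1)[unfolded pdet_4[OF U(5)] s(2-) d c2 c3] show ?thesis by (rule diff_left_imp_eq)
  qed
  have R': "\<exists>S\<subseteq>?U. i \<in> S \<and> j \<in> S \<and> k \<in> ?U - S \<and> l \<in> ?U - S \<and>
      (\<forall>p\<in>S. \<forall>q\<in>S. \<forall>x\<in>?U - S. \<forall>y\<in>?U - S. f p x * f q y = f p y * f q x)"
    if U: "i \<in> ?U" "j \<in> ?U" "k \<in> ?U" "l \<in> ?U" and d: "distinct [i, j, k, l]"
      and e: "f i k * f j l = f i l * f j k" for i j k l
  proof -
    have "mat_rank (submatrix A {i, j} {k, l}) = 1"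
      by (rule rank_1_submatrix_2[OF A]) (use U d e fnz in \<open>auto simp: f_def\<close>)
    then obtain S where S: "S \<subseteq> ?U" "i \<in> S" "j \<in> S" "k \<in> ?U - S" "l \<in> ?U - S"
      and rk: "mat_rank (submatrix A S (?U - S)) = 1"
      using R U d unfolding property_R_def by blast
    have "f p x * f q y = f p y * f q x" if "p \<in> S" "q \<in> S" "x \<in> ?U - S" "y \<in> ?U - S" for p q x y
      unfolding f_def by (rule rank_1_submatrix_minor[OF A rk]) (use that S in auto)
    then show ?thesis using S by blast
  qed
  have "minors ?U f g"
  proof
    \<comment> \<open>Nonvanishing of \<open>g\<close> comes from \<open>cyc2\<close>: the product
      \<open>g p q * g q p\<close> equals a nonzero product of entries of \<open>f\<close>.\<close>
    show "f p q \<noteq> 0 \<and> g p q \<noteq> 0" if "p \<in> ?U" "q \<in> ?U" "p \<noteq> q" for p q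
      using fnz[OF that] fnz[of q p] cyc2[OF that] that by auto
  next
    fix b i u v y assume U: "b \<in> ?U" "i \<in> ?U" "u \<in> ?U" "v \<in> ?U" "y \<in> ?U"
      and d: "distinct [b, i, u, v, y]"
    have dd: "distinct [u, v, i, b]" "distinct [i, b, u, v]" using d by auto
    show "f u y * f v b = f v y * f u b \<or> f y i * f u b = f u i * f y b" if "f u i * f v b = f v i * f u b"
    proof -
      have "f u i * f v b = f u b * f v i" using that by (simp add: mult.commute)
      then obtain S where S: "u \<in> S" "v \<in> S" "i \<in> ?U - S" "b \<in> ?U - S"
        and m: "\<forall>p\<in>S. \<forall>q\<in>S. \<forall>x\<in>?U - S. \<forall>y\<in>?U - S. f p x * f q y = f p y * f q x"
        using R'[OF U(3,4,2,1) dd(1)] by blast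
      show ?thesis
      proof (cases "y \<in> S")
        case True
        then have "f y i * f u b = f y b * f u i" using m S by blast
        then show ?thesis by (simp add: mult.commute)
      next
        case False
        then have "f u y * f v b = f u b * f v y" using m S U by blast
        then show ?thesis by (simp add: mult.commute)
      qed
    qed
    show "f y u * f b v = f y v * f b u \<or> f i y * f b u = f i u * f b y" if e: "f i u * f b v = f i v * f b u"
    proof -
      obtain S where S: "i \<in> S" "b \<in> S" "u \<in> ?U - S" "v \<in> ?U - S"
        and m: "\<forall>p\<in>S. \<forall>q\<in>S. \<forall>x\<in>?U - S. \<forall>y\<in>?U - S. f p x * f q y = f p y * f q x"
        using R'[OF U(2,1,3,4) dd(2) e] by blast
      show ?thesis
      proof (cases "y \<in> S")
        case True
        then show ?thesis using m S by blast
      next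
        case False
        then show ?thesis using m S U by blast
      qed
    qed
  qed (rule diag cyc2 cyc3 cyc4; assumption)+
  then show ?thesis by (simp add: f_def g_def)
qed

theorem theorem1p4:
  fixes A B :: "'a::field mat" and n :: nat
  assumes "A \<in> carrier_mat n n"
    and "B \<in> carrier_mat n n"
    and "property_R n A"
    and "\<And>S. S \<subseteq> {0..<n} \<Longrightarrow> S \<noteq> {} \<Longrightarrow> card S \<le> 4 \<Longrightarrow>
           det (principal_submatrix A S) = det (principal_submatrix B S)"
  shows "\<forall>S. S \<subseteq> {0..<n} \<longrightarrow> S \<noteq> {} \<longrightarrow>
           det (principal_submatrix A S) = det (principal_submatrix B S)"
proof -
  have "pdet (\<lambda>i k. A $$ (i, k)) S = pdet (\<lambda>i k. B $$ (i, k)) S"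
    if "S \<subseteq> {0..<n}" "card S \<le> 4" for S
  proof (cases "S = {}")
    case False
    then show ?thesis
      using assms(4)[OF that(1) False that(2)]
      by (simp add: det_principal_submatrix[OF assms(1) that(1)] det_principal_submatrix[OF assms(2) that(1)])
  qed simp
  then interpret minors "{0..<n}" "\<lambda>i k. A $$ (i, k)" "\<lambda>i k. B $$ (i, k)"
    by (rule minors_of_property_R[OF assms(1,3)])
  show ?thesis
  proof (intro allI impI)
    fix S assume S: "S \<subseteq> {0..<n}"
    then have "finite S" by (rule finite_subset) simp
    then show "det (principal_submatrix A S) = det (principal_submatrix B S)"
      using pdet_eq[OF _ S] by (simp add: det_principal_submatrix[OF _ S] assms(1,2))
  qed
qed

end
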